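(* Let $\mathcal T_0$ be an initial AMP marked mesh and $q\ge2$. Suppose that two consecutive events in a horizontal macro-generation-$q$ block (of a causal chain of a $\mathtt{RefineAMP}$ call on a descendant mesh of $\mathcal T_0$) bisect distinct edges $e_1$ and $e_2$ ($e_1$ by the parent event, $e_2$ by its causal child). Then the ordered pair $(\operatorname{cls}(e_1),\operatorname{cls}(e_2))$ is one of $$(H,H),\ (H,V),\ (V,V),\ (M_{\mathrm f},H),\ (M_{\mathrm f},V),\ (M_{\mathrm f},M_{\mathrm f}),\ (M_{\mathrm f},I_A),\ (I_A,V),\ (I_P,V),\ (I_P,M_{\mathrm f}).$$ Moreover, each of the transitions $H\to H$, $H\to V$, $V\to V$ preserves the anchor: $\alpha(e_1)=\alpha(e_2)$.
   Context: **Notation.** Tetrahedra are closed and nondegenerate in $\mathbb R^3$; $[v_0,v_1,\dots]$ is the convex hull; $\mathcal V(X),\mathcal E(X),\mathcal F(X)$ are the sets of vertices, edges, triangular faces of a tetrahedron or mesh $X$; $\operatorname{mid}(e)$ is the midpoint of $e$. **Marked tetrahedron.** A tetrahedron $K$ with a refinement edge $e(K)\in\mathcal E(K)$, a marked edge $\mu_F\in\mathcal E(F)$ for every $F\in\mathcal F(K)$, and a Boolean flag, such that the two faces containing $e(K)$ (refinement faces) have mark $e(K)$; the flag may be set only if the four face marks are coplanar. The other two faces are the nonrefinement faces. Types: $P$ if all face marks are coplanar ($P_u$ flag unset, $P_f$ flag set); $A$ if the marks of both nonrefinement faces meet $e(K)$ but the four marks are not coplanar; $O$ if neither of these two marks meets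 $e(K)$; $M$ if exactly one does. **Bisection.** For $K=[v_0,v_1,v_2,v_3]$ with $e(K)=[v_0,v_1]$ and $m=\operatorname{mid}([v_0,v_1])$, the children are $K_0=[v_0,m,v_2,v_3]$ and $K_1=[m,v_1,v_2,v_3]$, marked as follows: (B1) the inherited face of a child (a face of $K$) keeps its mark, and this mark is the refinement edge of the child; (B2) a cut face (a proper subtriangle of a face of $K$) is marked by its edge opposite $m$; (B3) the common new face $[m,v_2,v_3]$ is marked by $[v_2,v_3]$, except if $K$ has type $P_f$, when it is marked by $[m,w]$ with $w\in\{v_2,v_3\}$ the common old endpoint of the two child refinement edges; (B4) the child flags are set iff $K$ has type $P_u$. **Meshes.** A tetrahedral mesh of a polyhedral domain $\Omega\subset\mathbb R^3$ is a finite collection of tetrahedra with pairwise disjoint interiors and union $\overline\Omega$. It is conforming if two distinct elements intersect in the empty set, a common vertex, a common edge or a common face. An AMP marked mesh is a mesh of marked tetrahedra; it is conformingly marked if it is conforming and any shared face gets the same mark from both sides. An *initial AMP marked mesh* is a finite conformingly marked AMP mesh with all flags unset. Repeated bisection generates a binary tree below each $K\in\mathcal T_0$; $\operatorname{gen}(K)$ is the depth of $K$. A descendant mesh of $\mathcal T_0$ is the mesh of leaves after finitely many bisections starting from $\mathcal T_0$. **RefineAMP.** A hanging vertex of an element $K$ of a current mesh $\mathcal T$ is a vertex $z\in\mathcal V(\mathcal T)$ with $z\in\partial K\setminus\mathcal V(K)$. $\mathtt{RefineAMP}(\mathcal T,\mathcal M)$, for a conformingly marked AMP mesh $\mathcal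 T$ and $\mathcal M\subseteq\mathcal T$: batch zero bisects all elements of $\mathcal M$; then, as long as some elements of the current mesh have hanging vertices, the next batch simultaneously bisects all of them; return the resulting mesh. **Macro-generation.** $\mathcal U_q$ is the mesh obtained by bisecting uniformly $3q$ times every element of $\mathcal T_0$. Known facts: each $\mathcal U_q$ is conformingly marked and unflagged; for $q\ge1$ its elements are of type $A$ or $P_u$; the geometric edges in the uniform refinement tree are partitioned into the sets $\mathcal E(\mathcal U_q)$, and $\operatorname{mgen}(e)=q$ iff $e\in\mathcal E(\mathcal U_q)$. **Causal forest.** Fix one call. Every bisection is an event (identified with the tetrahedron bisected); batch-zero events are the roots. For every non-root event, bisecting $T$, there exist $e\in\mathcal E(T)$ such that $\operatorname{mid}(e)$ is a hanging vertex of $T$ immediately before the event, and an earlier event of the call that bisected exactly the geometric edge $e$. Choose one such earlier event for each non-root event and call it the parent. A causal chain is a directed path in the resulting forest. For a causal chain $K_0,\dots,K_J$, a horizontal macro-generation-$q$ block is a maximal consecutive subsequence with $\operatorname{mgen}(e(K_j))=q$. **Edge classes.** Let $q\ge2$ and $e\in\mathcal E(\mathcal U_q)$; classes are relative to $\mathcal U_{q-1}$. With $K\in\mathcal U_{q-1}$ and $m_{ab}=\operatorname{mid}([a,b])$ for $[a,b]\in\mathcal E(K)$, $\operatorname{cls}(e)$ is: $H$ if $e=[a,m_{ab}]$ or $[b,m_{ab}]$ for an edge $[a,b]$ of $K$; $V$ if $e=[c,m_{ab}]$ where the face $[a,b,c]$ of $K$ is marked by $[a,b]$; $M_{\mathrm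 f}$ if $e=[m_{ab},m_{ac}]$ or $[m_{ab},m_{bc}]$ where the face $[a,b,c]$ of $K$ is marked by $[a,b]$; $I_A$ (resp. $I_P$) if $e$ joins the midpoint of the refinement edge of $K$ to the midpoint of the opposite edge and $K$ is of type $A$ (resp. $P_u$). Every $e\in\mathcal E(\mathcal U_q)$ has exactly one class. For an $H$- or $V$-edge, the anchor $\alpha(e)$ is its unique endpoint that is a vertex of $\mathcal U_{q-1}$. *)

theory Defs
  imports "HOL-Analysis.Analysis"
begin

section \<open>Marked tetrahedra\<close>

text \<open>
  Vertices, edges and triangular faces are represented by their vertex sets in \<open>\<real>\<^sup>3\<close>:
  an edge \<open>[a,b]\<close> is the set \<open>{a, b}\<close>, a face \<open>[a,b,c]\<close> is the set \<open>{a, b, c}\<close>.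
  The closed simplex itself is the convex hull of that set.
\<close>

type_synonym point = "real ^ 3"

record marked_tet =
  verts :: "point set"
  redge :: "point set"
  fmark :: "point set \<Rightarrow> point set"
  flag  :: bool

definition body :: "marked_tet \<Rightarrow> point set" where
  "body K = convex hull (verts K)"

definition edges :: "marked_tet \<Rightarrow> point set set" where
  "edges K = {e. e \<subseteq> verts K \<and> card e = 2}"

definition faces :: "marked_tet \<Rightarrow> point set set" where
  "faces K = {F. F \<subseteq> verts K \<and> card F = 3}"

definition nonref_faces :: "marked_tet \<Rightarrow> point set set" where
  "nonref_faces K = {F \<in> faces K. \<not> redge K \<subseteq> F}"

definition emid :: "point set \<Rightarrow> point" where
  "emid e = (THE m. \<exists>a b. e = {a, b} \<and> m = midpoint a b)"

lemma emid_doubleton [simp]: "emid {a, b} = midpoint a b"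
  unfolding emid_def
  by (rule the_equality) (auto simp: doubleton_eq_iff midpoint_sym)

definition marks_coplanar :: "marked_tet \<Rightarrow> bool" where
  "marks_coplanar K \<longleftrightarrow> coplanar (\<Union>F\<in>faces K. convex hull (fmark K F))"

text \<open>
  Fixing the value of \<open>fmark\<close> off the faces of the tetrahedron makes equality of records
  coincide with equality of marked tetrahedra.
\<close>

definition is_marked_tet :: "marked_tet \<Rightarrow> bool" where
  "is_marked_tet K \<longleftrightarrow>
     card (verts K) = 4 \<and> \<not> affine_dependent (verts K) \<and>
     redge K \<in> edges K \<and>
     (\<forall>F\<in>faces K. fmark K F \<subseteq> F \<and> card (fmark K F) = 2) \<and>
     (\<forall>F\<in>faces K. redge K \<subseteq> F \<longrightarrow> fmark K F = redge K) \<and>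
     (flag K \<longrightarrow> marks_coplanar K) \<and>
     (\<forall>F. F \<notin> faces K \<longrightarrow> fmark K F = {})"

datatype tet_type = Type_Pu | Type_Pf | Type_A | Type_O | Type_M

text \<open>Two edges of a tetrahedron meet iff they share a vertex.\<close>

definition tet_type :: "marked_tet \<Rightarrow> tet_type" where
  "tet_type K =
     (if marks_coplanar K then (if flag K then Type_Pf else Type_Pu)
      else if \<forall>F\<in>nonref_faces K. fmark K F \<inter> redge K \<noteq> {} then Type_A
      else if \<forall>F\<in>nonref_faces K. fmark K F \<inter> redge K = {} then Type_O
      else Type_M)"


section \<open>Bisection\<close>

text \<open>
  The mark of the common new face. The refinement edges of the two children are the marks
  of the two nonrefinement faces of the bisected tetrahedron.
\<close>

definition new_face_mark :: "marked_tet \<Rightarrow> point set" where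
  "new_face_mark K =
     (if tet_type K = Type_Pf
      then {emid (redge K),
            THE w. w \<in> verts K - redge K \<and> (\<forall>F\<in>nonref_faces K. w \<in> fmark K F)}
      else verts K - redge K)"

text \<open>
  The child that keeps the endpoint \<open>v\<close> of the refinement edge. Its faces are the inherited
  face \<open>insert v opp\<close>, the new face \<open>insert m opp\<close>, and the two cut faces \<open>{v, m, w}\<close> with
  \<open>w \<in> opp\<close>, whose edge opposite \<open>m\<close> is obtained by deleting \<open>m\<close>.
\<close>

definition child :: "marked_tet \<Rightarrow> point \<Rightarrow> marked_tet" where
  "child K v =
     (let m = emid (redge K); opp = verts K - redge K; V = {v, m} \<union> opp
      in \<lparr> verts = V,
           redge = fmark K (insert v opp),
           fmark = (\<lambda>F. if \<not> (F \<subseteq> V \<and> card F = 3) then {}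
                        else if F = insert v opp then fmark K F
                        else if F = insert m opp then new_face_mark K
                        else F - {m}),
           flag = (tet_type K = Type_Pu) \<rparr>)"

definition children :: "marked_tet \<Rightarrow> marked_tet set" where
  "children K = child K ` redge K"

definition bisect_all :: "marked_tet set \<Rightarrow> marked_tet set \<Rightarrow> marked_tet set" where
  "bisect_all T B = (T - B) \<union> (\<Union>K\<in>B. children K)"


section \<open>Meshes\<close>

definition polyhedral_domain :: "point set \<Rightarrow> bool" where
  "polyhedral_domain \<Omega> \<longleftrightarrow>
     open \<Omega> \<and> connected \<Omega> \<and> \<Omega> \<noteq> {} \<and>
     (\<exists>P. finite P \<and> (\<forall>p\<in>P. polytope p) \<and> closure \<Omega> = \<Union>P)"

definition mesh_verts :: "marked_tet set \<Rightarrow> point set" where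
  "mesh_verts T = (\<Union>K\<in>T. verts K)"

definition mesh_edges :: "marked_tet set \<Rightarrow> point set set" where
  "mesh_edges T = (\<Union>K\<in>T. edges K)"

definition amp_mesh :: "point set \<Rightarrow> marked_tet set \<Rightarrow> bool" where
  "amp_mesh \<Omega> T \<longleftrightarrow>
     polyhedral_domain \<Omega> \<and> finite T \<and> (\<forall>K\<in>T. is_marked_tet K) \<and>
     (\<forall>K\<in>T. \<forall>L\<in>T. K \<noteq> L \<longrightarrow> interior (body K) \<inter> interior (body L) = {}) \<and>
     (\<Union>K\<in>T. body K) = closure \<Omega>"

text \<open>
  The common face \<open>S\<close> below may be empty, a vertex, an edge or a triangular face.
\<close>

definition conforming :: "marked_tet set \<Rightarrow> bool" where
  "conforming T \<longleftrightarrow>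
     (\<forall>K\<in>T. \<forall>L\<in>T. K \<noteq> L \<longrightarrow>
        (\<exists>S. S \<subseteq> verts K \<and> S \<subseteq> verts L \<and> card S \<le> 3 \<and> body K \<inter> body L = convex hull S))"

definition conformingly_marked :: "point set \<Rightarrow> marked_tet set \<Rightarrow> bool" where
  "conformingly_marked \<Omega> T \<longleftrightarrow>
     amp_mesh \<Omega> T \<and> conforming T \<and>
     (\<forall>K\<in>T. \<forall>L\<in>T. \<forall>F\<in>faces K \<inter> faces L. fmark K F = fmark L F)"

definition initial_amp_mesh :: "point set \<Rightarrow> marked_tet set \<Rightarrow> bool" where
  "initial_amp_mesh \<Omega> T0 \<longleftrightarrow> conformingly_marked \<Omega> T0 \<and> (\<forall>K\<in>T0. \<not> flag K)"

inductive descendant_mesh :: "marked_tet set \<Rightarrow> marked_tet set \<Rightarrow> bool" for T0 where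
  init: "descendant_mesh T0 T0"
| bisect: "descendant_mesh T0 T \<Longrightarrow> K \<in> T \<Longrightarrow> descendant_mesh T0 (bisect_all T {K})"


section \<open>RefineAMP and its causal forest\<close>

definition hanging_vertex :: "marked_tet set \<Rightarrow> marked_tet \<Rightarrow> point \<Rightarrow> bool" where
  "hanging_vertex T K z \<longleftrightarrow> z \<in> mesh_verts T \<and> z \<in> frontier (body K) - verts K"

definition hanging_elems :: "marked_tet set \<Rightarrow> marked_tet set" where
  "hanging_elems T = {K \<in> T. \<exists>z. hanging_vertex T K z}"

text \<open>
  \<open>amp_state T M n\<close> is the mesh immediately before batch \<open>n\<close> of the call with mesh \<open>T\<close> and
  set of elements \<open>M\<close>. Once no hanging vertices are left, all further batches are empty.
\<close>

primrec amp_state :: "marked_tet set \<Rightarrow> marked_tet set \<Rightarrow> nat \<Rightarrow> marked_tet set" where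
  "amp_state T M 0 = T"
| "amp_state T M (Suc n) =
     bisect_all (amp_state T M n) (if n = 0 then M else hanging_elems (amp_state T M n))"

definition amp_batch :: "marked_tet set \<Rightarrow> marked_tet set \<Rightarrow> nat \<Rightarrow> marked_tet set" where
  "amp_batch T M n = (if n = 0 then M else hanging_elems (amp_state T M n))"

definition events :: "marked_tet set \<Rightarrow> marked_tet set \<Rightarrow> marked_tet set" where
  "events T M = (\<Union>n. amp_batch T M n)"

text \<open>
  \<open>par\<close> is an admissible choice of causal parents. Bisections of one batch are simultaneous,
  so an earlier event is an event of an earlier batch.
\<close>

definition causal_parent ::
    "marked_tet set \<Rightarrow> marked_tet set \<Rightarrow> (marked_tet \<Rightarrow> marked_tet) \<Rightarrow> bool" where
  "causal_parent T M par \<longleftrightarrow>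
     (\<forall>n>0. \<forall>K\<in>amp_batch T M n.
        (\<exists>k<n. par K \<in> amp_batch T M k) \<and>
        redge (par K) \<in> edges K \<and>
        hanging_vertex (amp_state T M n) K (emid (redge (par K))))"

definition causal_chain ::
    "marked_tet set \<Rightarrow> marked_tet set \<Rightarrow> (marked_tet \<Rightarrow> marked_tet) \<Rightarrow> marked_tet list \<Rightarrow> bool" where
  "causal_chain T M par Ks \<longleftrightarrow>
     Ks \<noteq> [] \<and> set Ks \<subseteq> events T M \<and>
     (\<forall>j. Suc j < length Ks \<longrightarrow>
        Ks ! Suc j \<notin> amp_batch T M 0 \<and> par (Ks ! Suc j) = Ks ! j)"


section \<open>Macro-generations and edge classes\<close>

definition macro_mesh :: "marked_tet set \<Rightarrow> nat \<Rightarrow> marked_tet set" where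
  "macro_mesh T0 q = ((\<lambda>T. bisect_all T T) ^^ (3 * q)) T0"

text \<open>\<open>has_mgen T0 e q\<close> expresses that the edge \<open>e\<close> has macro-generation \<open>q\<close>.\<close>

definition has_mgen :: "marked_tet set \<Rightarrow> point set \<Rightarrow> nat \<Rightarrow> bool" where
  "has_mgen T0 e q \<longleftrightarrow> e \<in> mesh_edges (macro_mesh T0 q)"

text \<open>The events \<open>Ks ! a, \<dots>, Ks ! b\<close> form a horizontal block of macro-generation \<open>q\<close>.\<close>

definition horizontal_block ::
    "marked_tet set \<Rightarrow> nat \<Rightarrow> marked_tet list \<Rightarrow> nat \<Rightarrow> nat \<Rightarrow> bool" where
  "horizontal_block T0 q Ks a b \<longleftrightarrow>
     a \<le> b \<and> b < length Ks \<and>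
     (\<forall>j\<in>{a..b}. has_mgen T0 (redge (Ks ! j)) q) \<and>
     (0 < a \<longrightarrow> \<not> has_mgen T0 (redge (Ks ! (a - 1))) q) \<and>
     (Suc b < length Ks \<longrightarrow> \<not> has_mgen T0 (redge (Ks ! Suc b)) q)"

datatype edge_class = Cls_H | Cls_V | Cls_Mf | Cls_IA | Cls_IP

text \<open>
  Classes relative to a mesh \<open>U\<close>. The rules for \<open>Cls_H\<close> and \<open>Cls_Mf\<close> cover both halves of
  an edge and both midlines of a face, since \<open>a\<close> and \<open>b\<close> may be interchanged.
\<close>

inductive has_cls :: "marked_tet set \<Rightarrow> point set \<Rightarrow> edge_class \<Rightarrow> bool" for U where
  H: "K \<in> U \<Longrightarrow> {a, b} \<in> edges K \<Longrightarrow> has_cls U {a, midpoint a b} Cls_H"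
| V: "K \<in> U \<Longrightarrow> {a, b, c} \<in> faces K \<Longrightarrow> fmark K {a, b, c} = {a, b} \<Longrightarrow>
      has_cls U {c, midpoint a b} Cls_V"
| Mf: "K \<in> U \<Longrightarrow> {a, b, c} \<in> faces K \<Longrightarrow> fmark K {a, b, c} = {a, b} \<Longrightarrow>
      has_cls U {midpoint a b, midpoint a c} Cls_Mf"
| IA: "K \<in> U \<Longrightarrow> tet_type K = Type_A \<Longrightarrow>
      has_cls U {emid (redge K), emid (verts K - redge K)} Cls_IA"
| IP: "K \<in> U \<Longrightarrow> tet_type K = Type_Pu \<Longrightarrow>
      has_cls U {emid (redge K), emid (verts K - redge K)} Cls_IP"

definition cls :: "marked_tet set \<Rightarrow> nat \<Rightarrow> point set \<Rightarrow> edge_class" where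
  "cls T0 q e = (THE c. has_cls (macro_mesh T0 (q - 1)) e c)"

definition anchor :: "marked_tet set \<Rightarrow> nat \<Rightarrow> point set \<Rightarrow> point" where
  "anchor T0 q e = (THE v. v \<in> e \<and> v \<in> mesh_verts (macro_mesh T0 (q - 1)))"

end

(*
  An element K of U_q has the vertices {w, p, n, m}, where m is the midpoint of the refinement edge
  of an element of U_(q-1), {x, y, z} is a nonrefinement face of that element with mark {x, y},
  n = mid xy, p = mid xz and w is x or z. Every edge bisected with macro-generation q is an edge of
  such a K, bisected at K or one or two generations below it. The claim is then a case check on the
  marks of {w, p, n, m}; w is the common anchor of all H- and V-edges of K.

  That classes, anchors and macro-generations are well defined rests on U_q being conforming.
  Conformity is expressed by uniqueness of barycentric coordinates across all elements. Bisecting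
  an edge changes coordinates by an explicit rule depending only on that edge ("pull"), which has
  no effect when one endpoint has coordinate zero. Hence on a common face of two elements the three
  bisections act through the marked face alone, so uniqueness passes from U_q to U_(q+1).
*)
theory Submission
  imports Defs
begin

section \<open>Barycentric coordinates under bisection\<close>

text \<open>Meshes reached after only one or two uniform bisections need not be conforming, so the
  invariant is carried over three bisections at once. Describing intersections of children directly
  would need the geometry of all their relative positions. With coordinates extended by zero to all
  points, conformity is an equality of functions, and equalities can be composed along bisections.
  \<open>cls\<close> and \<open>anchor\<close> are definite descriptions, and
  \<open>has_mgen\<close> is a relation, so uniqueness has to be proved for each of them. The tool
  is \<open>support\<close>: it sees a point only through the mesh and not through one chosen
  element, and a midpoint remembers its edge. A bisected element may lie strictly below
  \<open>K\<close> in U_q, but the edge bisected by its parent has macro-generation q. Its endpoints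
  are therefore vertices of U_q, whereas bisection below \<open>K\<close> adds only points that are
  not; this brings the edge back to \<open>K\<close>. The types A and \<open>P_u\<close> of the
  elements of U_(q-1) enter through one fact: the mark \<open>{x, y}\<close> contains the kept
  endpoint of the refinement edge. This excludes, for instance, the transition from V to H.\<close>

definition nondeg :: "point set \<Rightarrow> bool" where
  "nondeg V \<longleftrightarrow> card V = 4 \<and> \<not> affine_dependent V"

text \<open>The coordinate function is total and vanishes off \<open>V\<close>. Coordinates taken in
  different tetrahedra can thus be compared by plain equality.\<close>

definition bary :: "point set \<Rightarrow> (point \<Rightarrow> real) \<Rightarrow> point \<Rightarrow> bool" where
  "bary V l x \<longleftrightarrow> (\<forall>u. 0 \<le> l u) \<and> (\<forall>u. u \<notin> V \<longrightarrow> l u = 0) \<and> sum l V = 1 \<and> (\<Sum>u\<in>V. l u *\<^sub>R u) = x"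

text \<open>
  \<open>pull a b l\<close> are the coordinates after bisecting \<open>[a,b]\<close> of the point that has coordinates \<open>l\<close>
  before: in the child that contains it, the smaller of \<open>l a\<close>, \<open>l b\<close> becomes zero.
\<close>

definition pull :: "point \<Rightarrow> point \<Rightarrow> (point \<Rightarrow> real) \<Rightarrow> point \<Rightarrow> real" where
  "pull a b l = (let t = min (l a) (l b) in
     (\<lambda>u. if u = a \<or> u = b then l u - t
          else if u = midpoint a b then l u + 2 * t else l u))"

lemma distinct_if_card_4: "card {a, b, c, d} = 4 \<longleftrightarrow> distinct [a, b, c, d]"
  by (auto simp: card_insert_if)

lemma distinct_if_card_3: "card {a, b, c} = 3 \<longleftrightarrow> distinct [a, b, c]"
  by (auto simp: card_insert_if)

lemma nondeg_distinct: "nondeg {a, b, c, d} \<Longrightarrow> distinct [a, b, c, d]"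
  by (simp only: nondeg_def distinct_if_card_4)

lemma midpoint_in_hull: "midpoint a b \<in> affine hull {a, b}"
  by (metis convex_hull_subset_affine_hull midpoint_in_closed_segment segment_convex_hull subsetD)

lemma nondeg_midpoint_notin:
  assumes "nondeg {a, b, c, d}"
  shows "midpoint a b \<notin> {a, b, c, d}"
proof -
  have d: "distinct [a, b, c, d]" and i: "\<not> affine_dependent {a, b, c, d}"
    using nondeg_distinct[OF assms] assms by (simp_all add: nondeg_def)
  have "midpoint a b \<noteq> u" if "u \<in> {c, d}" for u
  proof
    assume "midpoint a b = u"
    then have "u \<in> affine hull {a, b}" using midpoint_in_hull by metis
    moreover have "{a, b} \<subseteq> {a, b, c, d} - {u}" using that d by auto
    ultimately have "u \<in> affine hull ({a, b, c, d} - {u})" using hull_mono by blast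
    then show False using i that unfolding affine_dependent_def by blast
  qed
  then show ?thesis using d by auto
qed

text \<open>Since b is twice the midpoint minus a, the new vertices have an affine hull containing
  all old ones. Four points with a three-dimensional hull are affinely independent.\<close>

lemma nondeg_bisect:
  assumes "nondeg {a, b, c, d}"
  shows "nondeg {a, midpoint a b, c, d}"
proof -
  let ?V = "{a, midpoint a b, c, d}"
  have "2 *\<^sub>R midpoint a b + (-1) *\<^sub>R a = b"
    by (simp add: midpoint_def algebra_simps)
  then have "b \<in> affine hull {midpoint a b, a}"
    by (subst affine_hull_2) (force intro: exI[of _ "2::real"] exI[of _ "-1::real"])
  then have "b \<in> affine hull ?V" using hull_mono[of "{midpoint a b, a}" ?V] by blast
  moreover have "{a, c, d} \<subseteq> affine hull ?V" using hull_subset[of ?V affine] by blast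
  ultimately have "{a, b, c, d} \<subseteq> affine hull ?V" by blast
  then have "aff_dim {a, b, c, d} \<le> aff_dim ?V"
    using aff_dim_affine_hull aff_dim_subset by metis
  moreover have "aff_dim {a, b, c, d} = 3"
    using assms by (simp add: nondeg_def affine_independent_iff_card)
  moreover have "aff_dim ?V \<le> int (card ?V) - 1"
    by (rule aff_dim_le_card) simp
  moreover have "card ?V \<le> 4" by (simp add: card_insert_if)
  ultimately show ?thesis by (simp add: nondeg_def affine_independent_iff_card)
qed

lemma pull_commute: "pull a b l = pull b a l"
  unfolding pull_def by (auto simp: Let_def min.commute midpoint_sym fun_eq_iff)

lemma pull_ineffective:
  assumes "\<And>u. 0 \<le> l u" "l a = 0 \<or> l b = 0"
  shows "pull a b l = l"
proof -
  have "min (l a) (l b) = 0" using assms(1)[of a] assms(1)[of b] assms(2) by linarith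
  then show ?thesis by (simp add: pull_def fun_eq_iff)
qed

lemma pull_nonneg: "(\<And>u. 0 \<le> l u) \<Longrightarrow> 0 \<le> pull a b l u"
  by (auto simp: pull_def Let_def)

lemma pull_other: "u \<notin> {a, b, midpoint a b} \<Longrightarrow> pull a b l u = l u"
  by (auto simp: pull_def Let_def)

lemma pull_le: "l b \<le> l a \<Longrightarrow> pull a b l b = 0"
  by (auto simp: pull_def Let_def)

text \<open>If the zero sits at an endpoint, the pull is void; elsewhere only the midpoint gains
  weight. Zeros thus survive later pulls, which is what makes those pulls void in turn.\<close>

lemma pull_zero: "(\<And>u. 0 \<le> l u) \<Longrightarrow> u \<noteq> midpoint a b \<Longrightarrow> l u = 0 \<Longrightarrow> pull a b l u = 0"
  by (metis pull_ineffective pull_other insert_iff singletonD)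

text \<open>Coordinates are lifted from the child to the parent: the weight of the midpoint is split
  evenly between \<open>a\<close> and \<open>b\<close>. The difference \<open>l a - l b\<close> is
  then the weight of \<open>a\<close> in the child, so it is positive at interior points; this
  strict form identifies the child later on.\<close>

lemma bary_push:
  assumes nd: "nondeg {a, b, c, d}" and l1: "bary {a, midpoint a b, c, d} l1 x"
  obtains l where "bary {a, b, c, d} l x" "l b \<le> l a" "l1 = pull a b l"
    "(\<forall>u\<in>{a, midpoint a b, c, d}. 0 < l1 u) \<longrightarrow> (\<forall>u\<in>{a, b, c, d}. 0 < l u) \<and> l b < l a"
proof -
  define m where "m = midpoint a b"
  define l where "l u = (if u = a then l1 a + l1 m / 2 else if u = b then l1 m / 2
    else if u = m then 0 else l1 u)" for u
  have d: "distinct [a, b, c, d]" using nd by (rule nondeg_distinct)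
  have m: "m \<notin> {a, b, c, d}" unfolding m_def by (rule nondeg_midpoint_notin[OF nd])
  have nn: "0 \<le> l1 u" for u using l1 by (simp add: bary_def)
  have out: "l1 u = 0" if "u \<notin> {a, m, c, d}" for u
    using l1 that unfolding bary_def m_def by blast
  have b0: "l1 b = 0" by (rule out) (use d m in auto)
  have sums: "sum l1 {a, m, c, d} = 1" "(\<Sum>u\<in>{a, m, c, d}. l1 u *\<^sub>R u) = x"
    using l1 unfolding bary_def m_def by blast+
  have s: "l1 a + (l1 m + (l1 c + l1 d)) = 1"
    "l1 a *\<^sub>R a + (l1 m *\<^sub>R m + (l1 c *\<^sub>R c + l1 d *\<^sub>R d)) = x"
    using sums d m by auto
  have mm: "(l1 m / 2) *\<^sub>R a + (l1 m / 2) *\<^sub>R b = l1 m *\<^sub>R m"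
    by (simp add: m_def midpoint_def scaleR_add_right)
  have "bary {a, b, c, d} l x"
    unfolding bary_def
  proof (intro conjI)
    show "\<forall>u. 0 \<le> l u" using nn by (simp add: l_def)
    show "\<forall>u. u \<notin> {a, b, c, d} \<longrightarrow> l u = 0" using out by (auto simp: l_def)
    show "sum l {a, b, c, d} = 1" using d m s(1) by (auto simp: l_def)
    have "(\<Sum>u\<in>{a, b, c, d}. l u *\<^sub>R u) = l1 a *\<^sub>R a + ((l1 m / 2) *\<^sub>R a + (l1 m / 2) *\<^sub>R b) + (l1 c *\<^sub>R c + l1 d *\<^sub>R d)"
      using d m by (auto simp: l_def algebra_simps)
    also have "\<dots> = x" unfolding mm using s(2) by (simp add: algebra_simps)
    finally show "(\<Sum>u\<in>{a, b, c, d}. l u *\<^sub>R u) = x" .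
  qed
  moreover have "l b \<le> l a" using nn d by (simp add: l_def)
  moreover have "l1 = pull a b l"
  proof
    fix u
    \<comment> \<open>\<open>b\<close> received exactly half the weight of the midpoint, which
      explains the summand \<open>2 * t\<close> in \<open>pull\<close>.\<close>
    have mn: "min (l a) (l b) = l1 m / 2" using nn[of a] d by (auto simp: l_def)
    show "l1 u = pull a b l u"
      unfolding pull_def Let_def mn using b0 d m
      by (auto simp: l_def simp flip: m_def)
  qed
  moreover have "(\<forall>u\<in>{a, midpoint a b, c, d}. 0 < l1 u) \<longrightarrow> (\<forall>u\<in>{a, b, c, d}. 0 < l u) \<and> l b < l a"
    using d m by (auto simp: l_def simp flip: m_def)
  ultimately show ?thesis using that by blast
qed

lemma nondeg_bary_unique:
  assumes "nondeg V" "bary V l x" "bary V l' x"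
  shows "l = l'"
proof (rule ccontr)
  assume "l \<noteq> l'"
  then obtain v where "l v \<noteq> l' v" by blast
  then have "v \<in> V" using assms(2,3) by (force simp: bary_def)
  have "finite V" using assms(1) by (metis nondeg_def card.infinite zero_neq_numeral)
  moreover have "sum (\<lambda>u. l u - l' u) V = 0" using assms by (simp add: bary_def sum_subtractf)
  moreover have "(\<Sum>u\<in>V. (l u - l' u) *\<^sub>R u) = 0"
    using assms by (simp add: bary_def sum_subtractf scaleR_diff_left)
  ultimately have "affine_dependent V"
    using \<open>v \<in> V\<close> \<open>l v \<noteq> l' v\<close> affine_dependent_explicit_finite[of V]
    by (auto intro!: exI[of _ "\<lambda>u. l u - l' u"])
  then show False using assms(1) by (simp add: nondeg_def)
qed

text \<open>The conditions on vertices and face marks; the flag is tracked separately, in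
  \<open>good_mesh\<close> and \<open>macro_child\<close>.\<close>

definition wf_tet :: "marked_tet \<Rightarrow> bool" where
  "wf_tet K \<longleftrightarrow> nondeg (verts K) \<and> redge K \<in> edges K \<and>
     (\<forall>F\<in>faces K. fmark K F \<subseteq> F \<and> card (fmark K F) = 2) \<and>
     (\<forall>F\<in>faces K. redge K \<subseteq> F \<longrightarrow> fmark K F = redge K)"

lemma faces_eq:
  assumes "verts K = {a, b, c, d}" "distinct [a, b, c, d]"
  shows "faces K = {{a, b, c}, {a, b, d}, {a, c, d}, {b, c, d}}" (is "_ = ?R")
proof
  show "?R \<subseteq> faces K" using assms by (auto simp: faces_def)
  show "faces K \<subseteq> ?R"
  proof
    fix F assume "F \<in> faces K"
    then have F: "F \<subseteq> {a, b, c, d}" "card F = 3" by (auto simp: faces_def assms)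
    then have "card ({a, b, c, d} - F) = 1"
      using assms(2) by (subst card_Diff_subset) (auto intro: finite_subset)
    then obtain u where "{a, b, c, d} - F = {u}" by (auto simp: card_1_singleton_iff)
    then have "F = {a, b, c, d} - {u}" "u \<in> {a, b, c, d}" using F(1) by blast+
    then show "F \<in> ?R" using assms(2) by auto
  qed
qed

lemma nonref_faces_eq:
  assumes "verts K = {a, b, c, d}" "distinct [a, b, c, d]" "redge K = {a, b}"
  shows "nonref_faces K = {{a, c, d}, {b, c, d}}"
  using assms(2) unfolding nonref_faces_def faces_eq[OF assms(1,2)] assms(3) by auto

text \<open>Coplanar marks must miss a vertex: either the two nonrefinement marks close a triangle
  over \<open>{a, b}\<close>, or the endpoints of the marks exhaust all four vertices, which span a
  three-dimensional space.\<close>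

lemma marks_coplanar_iff:
  assumes v: "verts K = {a, b, c, d}" and nd: "nondeg {a, b, c, d}" and r: "redge K = {a, b}"
    and rf: "fmark K {a, b, c} = {a, b}" "fmark K {a, b, d} = {a, b}"
    and nr: "fmark K {a, c, d} \<subseteq> {a, c, d}" "card (fmark K {a, c, d}) = 2"
      "fmark K {b, c, d} \<subseteq> {b, c, d}" "card (fmark K {b, c, d}) = 2"
  shows "marks_coplanar K \<longleftrightarrow>
    (\<exists>w\<in>{c, d}. fmark K {a, c, d} = {a, w} \<and> fmark K {b, c, d} = {b, w})"
proof -
  have d: "distinct [a, b, c, d]" using nd by (rule nondeg_distinct)
  let ?U = "\<Union>F\<in>faces K. convex hull (fmark K F)"
  let ?A = "fmark K {a, c, d}" and ?B = "fmark K {b, c, d}"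
  have U: "?U = convex hull {a, b} \<union> convex hull ?A \<union> convex hull ?B"
    unfolding faces_eq[OF v d] using rf by auto
  have A: "?A = {a, c} \<or> ?A = {a, d} \<or> ?A = {c, d}" using nr(1,2) by (auto simp: card_2_iff)
  have B: "?B = {b, c} \<or> ?B = {b, d} \<or> ?B = {c, d}" using nr(3,4) by (auto simp: card_2_iff)
  show ?thesis
  proof
    assume "\<exists>w\<in>{c, d}. ?A = {a, w} \<and> ?B = {b, w}"
    then obtain w where w: "?A = {a, w}" "?B = {b, w}" by blast
    have "convex hull X \<subseteq> affine hull {a, b, w}" if "X \<subseteq> {a, b, w}" for X
      using convex_hull_subset_affine_hull[of X] hull_mono[OF that, of affine] by (rule order_trans)
    then have "?U \<subseteq> affine hull {a, b, w}" unfolding U w by simp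
    then show "marks_coplanar K" unfolding marks_coplanar_def coplanar_def by blast
  next
    assume "marks_coplanar K"
    then obtain p q s where p: "?U \<subseteq> affine hull {p, q, s}"
      unfolding marks_coplanar_def coplanar_def by blast
    show "\<exists>w\<in>{c, d}. ?A = {a, w} \<and> ?B = {b, w}"
    proof (rule ccontr)
      assume "\<not> ?thesis"
      \<comment> \<open>Outside the two triangle cases, \<open>?A\<close> and \<open>?B\<close>
        together contain both \<open>c\<close> and \<open>d\<close>.\<close>
      then have "{a, b, c, d} \<subseteq> {a, b} \<union> ?A \<union> ?B" using A B by auto
      moreover have "{a, b} \<union> ?A \<union> ?B \<subseteq> ?U" unfolding U by (meson Un_mono hull_subset)
      ultimately have "{a, b, c, d} \<subseteq> affine hull {p, q, s}" using p by (meson order_trans)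
      then have "aff_dim {a, b, c, d} \<le> aff_dim {p, q, s}"
        using aff_dim_affine_hull aff_dim_subset by metis
      moreover have "aff_dim {p, q, s} \<le> int (card {p, q, s}) - 1" by (rule aff_dim_le_card) simp
      moreover have "card {p, q, s} \<le> 3" by (simp add: card_insert_if)
      moreover have "aff_dim {a, b, c, d} = 3"
        using nd by (simp add: nondeg_def affine_independent_iff_card)
      ultimately show False by linarith
    qed
  qed
qed

section \<open>Three bisections of an unflagged tetrahedron\<close>

lemma child_bisect:
  assumes v: "verts K = {a, b, c, d}" and d: "distinct [a, b, c, d]" and r: "redge K = {a, b}"
    and m: "m = midpoint a b" "m \<notin> {a, b, c, d}"
  shows "verts (child K a) = {a, m, c, d}"
    "redge (child K a) = fmark K {a, c, d}"
    "fmark (child K a) {a, c, d} = fmark K {a, c, d}"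
    "fmark (child K a) {m, c, d} = new_face_mark K"
    "fmark (child K a) {a, m, c} = {a, c}"
    "fmark (child K a) {a, m, d} = {a, d}"
    "flag (child K a) \<longleftrightarrow> tet_type K = Type_Pu"
proof -
  have opp: "verts K - redge K = {c, d}" using d by (auto simp: v r)
  have e: "emid (redge K) = m" by (simp add: r m(1))
  note defs = child_def Let_def opp e
  show "verts (child K a) = {a, m, c, d}" "redge (child K a) = fmark K {a, c, d}"
    "flag (child K a) \<longleftrightarrow> tet_type K = Type_Pu"
    by (simp_all add: defs)
  have f: "{a, c, d} \<subseteq> {a, m} \<union> {c, d} \<and> card {a, c, d} = 3"
    "{m, c, d} \<subseteq> {a, m} \<union> {c, d} \<and> card {m, c, d} = 3"
    "{a, m, c} \<subseteq> {a, m} \<union> {c, d} \<and> card {a, m, c} = 3"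
    "{a, m, d} \<subseteq> {a, m} \<union> {c, d} \<and> card {a, m, d} = 3"
    using d m(2) by auto
  have ne: "{m, c, d} \<noteq> {a, c, d}" "{a, m, c} \<noteq> {a, c, d}" "{a, m, d} \<noteq> {a, c, d}"
    "{a, m, c} \<noteq> {m, c, d}" "{a, m, d} \<noteq> {m, c, d}"
    using d m(2) by auto
  have de: "{a, m, c} - {m} = {a, c}" "{a, m, d} - {m} = {a, d}" using d m(2) by auto
  show "fmark (child K a) {a, c, d} = fmark K {a, c, d}"
    "fmark (child K a) {m, c, d} = new_face_mark K"
    "fmark (child K a) {a, m, c} = {a, c}"
    "fmark (child K a) {a, m, d} = {a, d}"
    unfolding defs using f ne de by simp_all
qed

lemma new_face_mark_not_Pf:
  assumes "verts K = {a, b, c, d}" "distinct [a, b, c, d]" "redge K = {a, b}" "tet_type K \<noteq> Type_Pf"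
  shows "new_face_mark K = {c, d}"
  using assms by (auto simp: new_face_mark_def)

lemma new_face_mark_Pf:
  assumes "verts K = {a, b, c, d}" "distinct [a, b, c, d]" "redge K = {a, b}" "tet_type K = Type_Pf"
    and "fmark K {a, c, d} = {a, c}" "fmark K {b, c, d} = {b, c}"
  shows "new_face_mark K = {midpoint a b, c}"
proof -
  have "(THE w. w \<in> verts K - redge K \<and> (\<forall>F\<in>nonref_faces K. w \<in> fmark K F)) = c"
    using assms(2) unfolding nonref_faces_eq[OF assms(1-3)] assms(1,3)
    by (intro the_equality) (auto simp: assms(5,6))
  then show ?thesis using assms(3,4) by (simp add: new_face_mark_def)
qed

text \<open>
  The path from \<open>K\<close> to \<open>K'\<close> keeps in turn the endpoints \<open>v\<close>, \<open>x\<close>, \<open>w\<close> of the refinement edges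
  \<open>{v, v'}\<close>, \<open>{x, y}\<close>, \<open>{w, w'} = {x, z}\<close>. The roles of \<open>x\<close> and \<open>y\<close> may be exchanged, so each of
  the eight great-grandchildren arises.
\<close>

locale macro_child =
  fixes K K' :: marked_tet and v v' x y z w w' :: point
  assumes wf: "wf_tet K" and unflagged: "\<not> flag K"
    and verts: "verts K = {v', x, y, z}" and redge: "redge K = {v, v'}" and v: "v \<in> {x, y, z}"
    and mark: "fmark K {x, y, z} = {x, y}"
    and w: "w = x \<and> w' = z \<or> w = z \<and> w' = x"
    and K': "K' = child (child (child K v) x) w"
begin

definition "m = midpoint v v'"
definition "n = midpoint x y"
definition "p = midpoint x z"
definition "D = child K v"
definition "G = child D x"

lemma nd: "nondeg {v', x, y, z}" using wf verts by (simp add: wf_tet_def)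

lemma dist0: "distinct [v', x, y, z]" using nd by (rule nondeg_distinct)

lemma nd_D: "nondeg {x, y, z, m}"
  using v nondeg_bisect[of x v' y z] nondeg_bisect[of y v' x z] nondeg_bisect[of z v' x y] nd
  by (auto simp: m_def insert_commute)

lemma nd_G: "nondeg {x, n, z, m}"
  unfolding n_def by (rule nondeg_bisect[OF nd_D])

lemma nd_K': "nondeg {w, p, n, m}"
proof -
  have "nondeg {x, z, n, m}" "nondeg {z, x, n, m}" using nd_G by (simp_all add: insert_commute)
  from nondeg_bisect[OF this(1)] nondeg_bisect[OF this(2)] w show ?thesis
    by (auto simp: p_def midpoint_sym insert_commute)
qed

lemma m_notin: "m \<notin> {v', x, y, z}"
  using v nondeg_midpoint_notin[of x v' y z] nondeg_midpoint_notin[of y v' x z]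
    nondeg_midpoint_notin[of z v' x y] nd
  by (auto simp: m_def insert_commute)

lemma n_notin: "n \<notin> {v', x, y, z, m}"
  using nondeg_midpoint_notin[of x y z m] nondeg_midpoint_notin[of x y z v'] nd nd_D
  by (auto simp: n_def insert_commute)

lemma p_notin: "p \<notin> {v', x, y, z, m, n}"
  using nondeg_midpoint_notin[of x z n m] nondeg_midpoint_notin[of x z y v'] nd nd_G
  by (auto simp: p_def insert_commute)

lemma dist: "distinct [v', x, y, z, m, n, p]"
  using dist0 m_notin n_notin p_notin by auto

lemma w_dist: "w \<in> {x, z}" "w' \<in> {x, z}" "w \<noteq> w'" "{w, w'} = {x, z}"
  using w dist0 by auto

lemma not_Pf: "tet_type K \<noteq> Type_Pf"
  using unflagged by (simp add: tet_type_def)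

text \<open>Wherever \<open>v\<close> lies in the face \<open>{x, y, z}\<close>, every face of
  \<open>D\<close> through \<open>m\<close> is marked by its edge opposite \<open>m\<close>: the cut
  faces by (B2), the new face by (B3) because \<open>K\<close> is unflagged. Hence one list of marks
  covers the three positions of \<open>v\<close>.\<close>

lemma D_facts:
  "verts D = {x, y, z, m}" "redge D = {x, y}" "fmark D {x, y, z} = {x, y}"
  "fmark D {x, y, m} = {x, y}" "fmark D {x, z, m} = {x, z}" "fmark D {y, z, m} = {y, z}"
  "flag D \<longleftrightarrow> tet_type K = Type_Pu"
proof -
  have *: "verts D = {x, y, z, m} \<and> redge D = {x, y} \<and> fmark D {x, y, z} = {x, y} \<and>
    fmark D {x, y, m} = {x, y} \<and> fmark D {x, z, m} = {x, z} \<and> fmark D {y, z, m} = {y, z} \<and>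
    (flag D \<longleftrightarrow> tet_type K = Type_Pu)"
    if "(v, c, d) \<in> {(x, y, z), (y, x, z), (z, x, y)}" for c d
  proof -
    have V: "verts K = {v, v', c, d}" and dd: "distinct [v, v', c, d]" and mm: "m \<notin> {v, v', c, d}"
      using that dist0 m_notin verts by auto
    note cb = child_bisect[OF V dd redge m_def mm, folded D_def]
      new_face_mark_not_Pf[OF V dd redge not_Pf]
    show ?thesis
      using that cb mark by (elim insertE emptyE) (simp_all add: insert_commute)
  qed
  have "\<exists>c d. (v, c, d) \<in> {(x, y, z), (y, x, z), (z, x, y)}"
    using v by blast
  then show "verts D = {x, y, z, m}" "redge D = {x, y}" "fmark D {x, y, z} = {x, y}"
    "fmark D {x, y, m} = {x, y}" "fmark D {x, z, m} = {x, z}" "fmark D {y, z, m} = {y, z}"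
    "flag D \<longleftrightarrow> tet_type K = Type_Pu" using * by meson+
qed

text \<open>All marks of \<open>D\<close> lie in the plane of the face \<open>{x, y, z}\<close>, so
  only the flag inherited through (B4) distinguishes the two cases.\<close>

lemma D_type: "tet_type D = (if tet_type K = Type_Pu then Type_Pf else Type_Pu)"
proof -
  have dd: "distinct [x, y, z, m]" using dist by simp
  have "marks_coplanar D"
    using D_facts dd by (subst marks_coplanar_iff[OF _ nd_D]) auto
  then show ?thesis using D_facts(7) by (simp add: tet_type_def)
qed

text \<open>The mark of the new face \<open>{n, z, m}\<close> carries the exception in (B3): if
  \<open>K\<close> is of type \<open>P_u\<close>, then \<open>D\<close> is of type
  \<open>P_f\<close>, and \<open>z\<close> is the common old endpoint of the marks
  \<open>{x, z}\<close> and \<open>{y, z}\<close>.\<close>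

lemma G_facts:
  "verts G = {x, n, z, m}" "redge G = {x, z}" "fmark G {x, z, m} = {x, z}"
  "fmark G {n, z, m} = (if tet_type K = Type_Pu then {n, z} else {z, m})"
  "fmark G {x, n, z} = {x, z}" "fmark G {x, n, m} = {x, m}"
  "flag G \<longleftrightarrow> tet_type K \<noteq> Type_Pu"
proof -
  have dd: "distinct [x, y, z, m]" and nn: "n \<notin> {x, y, z, m}" using dist by auto
  note cb = child_bisect[OF D_facts(1) dd D_facts(2) n_def nn, folded G_def]
  show "verts G = {x, n, z, m}" "redge G = {x, z}" "fmark G {x, z, m} = {x, z}"
    "fmark G {x, n, z} = {x, z}" "fmark G {x, n, m} = {x, m}"
    "flag G \<longleftrightarrow> tet_type K \<noteq> Type_Pu"
    using cb D_facts D_type by auto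
  show "fmark G {n, z, m} = (if tet_type K = Type_Pu then {n, z} else {z, m})"
    using cb(4) D_type new_face_mark_not_Pf[OF D_facts(1) dd D_facts(2)]
      new_face_mark_Pf[OF D_facts(1) dd D_facts(2) _ D_facts(5,6)]
    by (auto simp: n_def)
qed

text \<open>Over the refinement edge \<open>{x, z}\<close> one nonrefinement mark is
  \<open>{x, m}\<close>; it closes a triangle with \<open>{z, m}\<close> but not with
  \<open>{n, z}\<close>. In neither case is \<open>G\<close> of type \<open>P_u\<close>, so the
  third bisection yields unflagged elements.\<close>

lemma G_type: "tet_type G \<noteq> Type_Pu" "tet_type G = Type_Pf \<longleftrightarrow> tet_type K \<noteq> Type_Pu"
proof -
  have nG: "nondeg {x, z, n, m}" and V: "verts G = {x, z, n, m}"
    using nd_G G_facts(1) by (simp_all add: insert_commute)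
  have f: "fmark G {x, z, n} = {x, z}" "fmark G {x, z, m} = {x, z}" "fmark G {x, n, m} = {x, m}"
    "fmark G {z, n, m} = (if tet_type K = Type_Pu then {n, z} else {z, m})"
    using G_facts by (simp_all add: insert_commute)
  have "marks_coplanar G \<longleftrightarrow> tet_type K \<noteq> Type_Pu"
    using f dist by (subst marks_coplanar_iff[OF V nG G_facts(2)]) (auto simp: doubleton_eq_iff)
  then show "tet_type G \<noteq> Type_Pu" "tet_type G = Type_Pf \<longleftrightarrow> tet_type K \<noteq> Type_Pu"
    using G_facts(7) by (auto simp: tet_type_def)
qed

lemma K'_eq: "K' = child G w" using K' by (simp add: G_def D_def)

text \<open>\<open>{w, n, m}\<close> is the face inherited from \<open>G\<close>, so its mark is
  also the refinement edge; the two faces of \<open>G\<close> in question differ in kind only when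
  \<open>K\<close> is of type \<open>P_u\<close>. If \<open>K\<close> is not, then \<open>G\<close>
  is of type \<open>P_f\<close>, and the exception in (B3) applies with common old endpoint
  \<open>m\<close>.\<close>

lemma K'_facts:
  "verts K' = {w, p, n, m}" "\<not> flag K'"
  "redge K' = (if tet_type K = Type_Pu \<and> w = z then {w, n} else {w, m})"
  "fmark K' {w, n, m} = (if tet_type K = Type_Pu \<and> w = z then {w, n} else {w, m})"
  "fmark K' {w, p, m} = {w, m}" "fmark K' {w, p, n} = {w, n}"
  "fmark K' {p, n, m} = (if tet_type K = Type_Pu then {n, m} else {p, m})"
proof -
  have V: "verts G = {w, w', n, m}" and dd: "distinct [w, w', n, m]" and r: "redge G = {w, w'}"
    and pp: "p \<notin> {w, w', n, m}" "p = midpoint w w'"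
  proof -
    show "verts G = {w, w', n, m}" "redge G = {w, w'}"
      using G_facts(1,2) w by (elim disjE; simp add: insert_commute)+
    show "distinct [w, w', n, m]" "p \<notin> {w, w', n, m}"
      using dist w by (elim disjE; force)+
    show "p = midpoint w w'"
      using w by (elim disjE) (simp_all add: p_def midpoint_sym)
  qed
  note cb = child_bisect[OF V dd r pp(2,1), folded K'_eq]
  have f: "fmark G {w, n, m} = (if tet_type K = Type_Pu \<and> w = z then {w, n} else {w, m})"
    using G_facts w dist by (auto simp: insert_commute)
  have f': "fmark G {w', n, m} = {w', m}" if "tet_type K \<noteq> Type_Pu"
    using G_facts w dist that by (auto simp: insert_commute)
  show "verts K' = {w, p, n, m}" "\<not> flag K'" "fmark K' {w, p, m} = {w, m}" "fmark K' {w, p, n} = {w, n}"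
    using cb G_type by simp_all
  show "redge K' = (if tet_type K = Type_Pu \<and> w = z then {w, n} else {w, m})"
    "fmark K' {w, n, m} = (if tet_type K = Type_Pu \<and> w = z then {w, n} else {w, m})"
    using cb(2,3) f by simp_all
  have V2: "verts G = {w, w', m, n}" and dd2: "distinct [w, w', m, n]"
    using V dd by (auto simp: insert_commute)
  have "new_face_mark G = (if tet_type K = Type_Pu then {n, m} else {p, m})"
  proof (cases "tet_type K = Type_Pu")
    case True
    then show ?thesis using new_face_mark_not_Pf[OF V dd r] G_type by simp
  next
    case False
    then show ?thesis
      using new_face_mark_Pf[OF V2 dd2 r] G_type f f' pp(2) by (simp add: insert_commute)
  qed
  then show "fmark K' {p, n, m} = (if tet_type K = Type_Pu then {n, m} else {p, m})"
    using cb(4) by simp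
qed

lemma dist_K': "distinct [w, p, n, m]" using dist w by auto

lemma faces_K': "faces K' = {{w, p, n}, {w, p, m}, {w, n, m}, {p, n, m}}"
  by (rule faces_eq[OF K'_facts(1) dist_K'])

lemma wf_K': "wf_tet K'"
  unfolding wf_tet_def
proof (intro conjI)
  show "nondeg (verts K')" using nd_K' by (simp add: K'_facts(1))
  show "redge K' \<in> edges K'" using dist_K' by (auto simp: edges_def K'_facts(1,3))
  show "\<forall>F\<in>faces K'. fmark K' F \<subseteq> F \<and> card (fmark K' F) = 2"
    unfolding faces_K' using dist_K' by (auto simp: K'_facts)
  show "\<forall>F\<in>faces K'. redge K' \<subseteq> F \<longrightarrow> fmark K' F = redge K'"
    unfolding faces_K' using dist_K' by (auto simp: K'_facts)
qed

lemma nonref_faces_K':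
  "nonref_faces K' = (if tet_type K = Type_Pu \<and> w = z then {{w, p, m}, {p, n, m}} else {{w, p, n}, {p, n, m}})"
  unfolding nonref_faces_def faces_K' K'_facts(3) using dist_K' by auto

text \<open>For \<open>P_u\<close> the marks are the sides of the triangle \<open>{w, n, m}\<close>.
  Otherwise they are \<open>{w, m}\<close>, \<open>{w, n}\<close> and \<open>{p, m}\<close>: they
  reach all four vertices, and both nonrefinement marks meet \<open>{w, m}\<close>.\<close>

lemma K'_type: "tet_type K' = (if tet_type K = Type_Pu then Type_Pu else Type_A)"
proof -
  have V: "verts K' = {w, m, p, n}" "verts K' = {w, n, p, m}"
    and N: "nondeg {w, m, p, n}" "nondeg {w, n, p, m}"
    using nd_K' K'_facts(1) by (simp_all add: insert_commute)
  have cop: "marks_coplanar K' \<longleftrightarrow> tet_type K = Type_Pu"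
  proof (cases "tet_type K = Type_Pu \<and> w = z")
    case True
    then have r: "redge K' = {w, n}" by (simp add: K'_facts)
    show ?thesis using K'_facts dist_K' True
      by (subst marks_coplanar_iff[OF V(2) N(2) r]) (auto simp: insert_commute doubleton_eq_iff)
  next
    case False
    then have r: "redge K' = {w, m}" by (auto simp: K'_facts)
    show ?thesis using K'_facts dist_K' False
      by (subst marks_coplanar_iff[OF V(1) N(1) r]) (auto simp: insert_commute doubleton_eq_iff)
  qed
  show ?thesis
    using cop K'_facts by (auto simp: tet_type_def nonref_faces_K')
qed

end

lemma macro_child_exists:
  assumes wf: "wf_tet K" and uf: "\<not> flag K" and v: "v \<in> redge K" and x: "x \<in> redge (child K v)"
    and w: "w \<in> redge (child (child K v) x)"
  obtains v' y z w' where "macro_child K (child (child (child K v) x) w) v v' x y z w w'"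
proof -
  have c4: "card (verts K) = 4" and c2: "card (redge K) = 2" and rs: "redge K \<subseteq> verts K"
    using wf by (auto simp: wf_tet_def nondeg_def edges_def)
  obtain v' where r: "redge K = {v, v'}" "v \<noteq> v'" using c2 v unfolding card_2_iff by (elim exE) (auto simp: insert_commute intro: that)
  have "card (verts K - redge K) = 2" using c4 c2 rs by (simp add: card_Diff_subset finite_subset card_ge_0_finite)
  then obtain c d where cd: "verts K - redge K = {c, d}" "c \<noteq> d" by (auto simp: card_2_iff)
  then have V: "verts K = {v, v', c, d}" using rs r by auto
  have ND: "nondeg {v, v', c, d}" using wf V by (simp add: wf_tet_def)
  then have d: "distinct [v, v', c, d]" by (rule nondeg_distinct)
  have mm: "midpoint v v' \<notin> {v, v', c, d}" using nondeg_midpoint_notin[OF ND] .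
  have rD: "redge (child K v) = fmark K {v, c, d}"
    by (rule child_bisect[OF V d r(1) refl mm])
  have "{v, c, d} \<in> faces K" unfolding faces_eq[OF V d] by simp
  then have fm: "fmark K {v, c, d} \<subseteq> {v, c, d}" "card (fmark K {v, c, d}) = 2"
    using wf by (auto simp: wf_tet_def)
  obtain y where y: "fmark K {v, c, d} = {x, y}" "x \<noteq> y"
    using fm(2) x rD unfolding card_2_iff by (elim exE) (auto simp: insert_commute intro: that)
  have "card ({v, c, d} - {x, y}) = 1"
    using y fm d by (simp add: card_Diff_subset)
  then obtain z where z: "{v, c, d} - {x, y} = {z}" by (auto simp: card_1_singleton_iff)
  then have F: "{v, c, d} = {x, y, z}" using fm y by auto
  have V': "verts K = {v', x, y, z}" using V F by auto
  have vv: "v \<in> {x, y, z}" using F by auto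
  have mk: "fmark K {x, y, z} = {x, y}" using F y by simp
  \<comment> \<open>The locale is entered with the third kept vertex taken to be \<open>x\<close>,
    only to learn that the second descendant has refinement edge \<open>{x, z}\<close>; this then
    locates the given \<open>w\<close>.\<close>
  interpret M: macro_child K "child (child (child K v) x) x" v v' x y z x z
    by unfold_locales (use wf uf V' r vv mk in auto)
  have "w \<in> {x, z}" using w M.G_facts(2) by (simp add: M.G_def M.D_def)
  then have "macro_child K (child (child (child K v) x) w) v v' x y z w (if w = x then z else x)"
    by unfold_locales (use wf uf V' r vv mk in auto)
  then show ?thesis using that by blast
qed

section \<open>Coordinates on a marked face\<close>

lemma third_vertex_eq:
  assumes "{a, b, c} = {a', b', c'}" "{a, b} = {a', b'}" "distinct [a, b, c]"
  shows "c = c'"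
proof -
  have "c \<in> {a', b', c'}" "c \<notin> {a', b'}" unfolding assms(1,2)[symmetric] using assms(3) by auto
  then show ?thesis by blast
qed

text \<open>The subdivision of a triangle with mark \<open>{a, b}\<close>: first the marked edge is
  halved, then \<open>{a, c}\<close> in one half and \<open>{b, c}\<close> in the other. For a given
  point at most one of the last two pulls has an effect.\<close>

definition refine_face :: "point \<Rightarrow> point \<Rightarrow> point \<Rightarrow> (point \<Rightarrow> real) \<Rightarrow> point \<Rightarrow> real" where
  "refine_face a b c l = pull b c (pull a c (pull a b l))"

lemma pull_zero_or:
  assumes "\<And>u. 0 \<le> l u"
  shows "pull a b l a = 0 \<or> pull a b l b = 0"
  by (auto simp: pull_def Let_def min_def)

text \<open>The first pull empties \<open>a\<close> or \<open>b\<close>, which makes one of the two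
  remaining pulls void. The inequalities with midpoints keep the other pull from refilling the
  emptied vertex.\<close>

lemma refine_face_commute:
  assumes nn: "\<And>u. 0 \<le> l u" and m: "b \<noteq> midpoint a c" "a \<noteq> midpoint b c"
  shows "refine_face a b c l = refine_face b a c l"
proof -
  let ?l = "pull a b l"
  have nn2: "0 \<le> ?l u" for u using pull_nonneg nn by blast
  have "?l a = 0 \<or> ?l b = 0" using pull_zero_or nn by blast
  then have "pull b c (pull a c ?l) = pull a c (pull b c ?l)"
  proof
    assume a: "?l a = 0"
    then have "pull b c ?l a = 0" by (rule pull_zero[rotated 2]) (use m(2) nn2 a in simp_all)
    then have "pull a c (pull b c ?l) = pull b c ?l"
      by (intro pull_ineffective pull_nonneg nn2) simp
    moreover have "pull a c ?l = ?l" using a by (intro pull_ineffective nn2) simp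
    ultimately show ?thesis by simp
  next
    assume b: "?l b = 0"
    then have "pull a c ?l b = 0" by (rule pull_zero[rotated 2]) (use m(1) nn2 b in simp_all)
    then have "pull b c (pull a c ?l) = pull a c ?l"
      by (intro pull_ineffective pull_nonneg nn2) simp
    moreover have "pull b c ?l = ?l" using b by (intro pull_ineffective nn2) simp
    ultimately show ?thesis by simp
  qed
  then show ?thesis by (simp add: refine_face_def pull_commute[of b a])
qed

lemma refine_face_ordered:
  assumes nn: "\<And>u. 0 \<le> l u" and m: "b \<noteq> midpoint a c" and le: "l b \<le> l a"
  shows "refine_face a b c l = pull a c (pull a b l)"
proof -
  have nn2: "0 \<le> pull a b l u" for u using pull_nonneg nn by blast
  have "pull a b l b = 0" using le by (rule pull_le)
  then have "pull a c (pull a b l) b = 0" by (rule pull_zero[rotated 2]) (use m nn2 in simp_all)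
  then show ?thesis unfolding refine_face_def
    by (intro pull_ineffective pull_nonneg nn2) simp
qed

text \<open>A point on the edge opposite \<open>u\<close> is affected by neither edge at
  \<open>u\<close>. The result no longer shows which edge of the face was marked, so elements
  sharing only an edge agree on it as well.\<close>

lemma refine_face_zero:
  assumes nn: "\<And>u. 0 \<le> l u" and F: "{a, b, c} = {u, d, e}" "distinct [a, b, c]" "distinct [u, d, e]"
    and m: "c \<noteq> midpoint a b" "b \<noteq> midpoint a c" and z: "l u = 0"
  shows "refine_face a b c l = pull d e l"
proof -
  have "u = a \<and> {b, c} = {d, e} \<or> u = b \<and> {a, c} = {d, e} \<or> u = c \<and> {a, b} = {d, e}"
  proof -
    have "{d, e} = {a, b, c} - {u}" using F(1,3) by auto
    moreover have "u \<in> {a, b, c}" using F(1) by auto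
    ultimately show ?thesis using F(2) by (elim insertE emptyE) auto
  qed
  then consider "u = a" "{b, c} = {d, e}" | "u = b" "{a, c} = {d, e}" | "u = c" "{a, b} = {d, e}"
    by blast
  then show ?thesis
  proof cases
    case 1
    then have "pull d e l = pull b c l" by (metis doubleton_eq_iff pull_commute)
    then show ?thesis using 1 z nn by (simp add: refine_face_def pull_ineffective)
  next
    case 2
    then have *: "pull d e l = pull a c l" by (metis doubleton_eq_iff pull_commute)
    have nn2: "0 \<le> pull a c l u" for u using pull_nonneg nn by blast
    have "pull a c l b = 0" using z 2 m(2) nn by (intro pull_zero) auto
    then have "pull b c (pull a c l) = pull a c l" using nn2 by (intro pull_ineffective) auto
    then show ?thesis using 2 * z nn by (simp add: refine_face_def pull_ineffective)
  next
    case 3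
    then have *: "pull d e l = pull a b l" by (metis doubleton_eq_iff pull_commute)
    have nn2: "0 \<le> pull a b l u" for u using pull_nonneg nn by blast
    have "pull a b l c = 0" using z 3 m(1) nn by (intro pull_zero) auto
    then have "pull a c (pull a b l) = pull a b l" "pull b c (pull a b l) = pull a b l"
      using nn2 by (auto intro!: pull_ineffective)
    then show ?thesis using * by (simp add: refine_face_def)
  qed
qed

section \<open>Coordinates in a macro child in terms of the parent\<close>

context macro_child
begin

text \<open>\<open>bary_push\<close> is applied three times, from the last bisection upwards. The
  last pull depends only on the unordered edge \<open>{x, z}\<close>, so \<open>w\<close> is
  compared with \<open>w'\<close> only in the strict clause, which concerns interior points.\<close>

lemma bary_macro_child:
  assumes "bary (verts K') l q"
  obtains l0 where "bary (verts K) l0 q" "l0 v' \<le> l0 v" "pull v v' l0 y \<le> pull v v' l0 x"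
    "l = pull x z (pull x y (pull v v' l0))"
    "(\<forall>u\<in>verts K'. 0 < l u) \<longrightarrow> (\<forall>u\<in>verts K. 0 < l0 u) \<and> l0 v' < l0 v \<and>
       pull v v' l0 y < pull v v' l0 x \<and> pull x y (pull v v' l0) w' < pull x y (pull v v' l0) w"
proof -
  have nG: "nondeg {w, w', n, m}" and p: "p = midpoint w w'" and wG: "{w, w', n, m} = {x, n, z, m}"
    using nd_G w by (auto simp: p_def midpoint_sym insert_commute)
  have "bary {w, midpoint w w', n, m} l q" using assms K'_facts(1) p by simp
  then obtain l2 where l2: "bary {w, w', n, m} l2 q" "l = pull w w' l2"
    "(\<forall>u\<in>{w, midpoint w w', n, m}. 0 < l u) \<longrightarrow> (\<forall>u\<in>{w, w', n, m}. 0 < l2 u) \<and> l2 w' < l2 w"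
    using bary_push[OF nG] by metis
  have "bary {x, midpoint x y, z, m} l2 q" using l2(1) wG by (simp add: n_def)
  then obtain l1 where l1: "bary {x, y, z, m} l1 q" "l1 y \<le> l1 x" "l2 = pull x y l1"
    "(\<forall>u\<in>{x, midpoint x y, z, m}. 0 < l2 u) \<longrightarrow> (\<forall>u\<in>{x, y, z, m}. 0 < l1 u) \<and> l1 y < l1 x"
    using bary_push[OF nd_D] by metis
  obtain c d where cd: "{v, c, d} = {x, y, z}" using v by auto
  have nK: "nondeg {v, v', c, d}" and sK: "{v, v', c, d} = verts K"
    and sD: "{v, midpoint v v', c, d} = {x, y, z, m}"
  proof -
    have *: "{v, u, c, d} = insert u {v, c, d}" for u by auto
    show "{v, v', c, d} = verts K" "{v, midpoint v v', c, d} = {x, y, z, m}"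
      unfolding * cd verts m_def by auto
    then show "nondeg {v, v', c, d}" using wf by (simp add: wf_tet_def)
  qed
  have "bary {v, midpoint v v', c, d} l1 q" using l1(1) sD by simp
  then obtain l0 where l0: "bary {v, v', c, d} l0 q" "l0 v' \<le> l0 v" "l1 = pull v v' l0"
    "(\<forall>u\<in>{v, midpoint v v', c, d}. 0 < l1 u) \<longrightarrow> (\<forall>u\<in>{v, v', c, d}. 0 < l0 u) \<and> l0 v' < l0 v"
    using bary_push[OF nK] by metis
  have "l = pull x z l2" using l2(2) w pull_commute by metis
  moreover have "(\<forall>u\<in>verts K'. 0 < l u) \<longrightarrow> (\<forall>u\<in>verts K. 0 < l0 u) \<and> l0 v' < l0 v \<and> l1 y < l1 x \<and> l2 w' < l2 w"
    using l2(3) l1(4) l0(4) unfolding K'_facts(1) p sK sD wG n_def[symmetric] by blast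
  ultimately show ?thesis
    using that l0(1,2) l1(2) l1(3) l0(3) sK by simp
qed

text \<open>The bisections of the whole element are seen on one of its faces. A pull along an edge
  leaving the face is void there, and what remains is governed by the mark of that face. This is the
  step that lets two neighbours be compared.\<close>

lemma bary_face:
  assumes l0: "bary (verts K) l0 q" "l0 v' \<le> l0 v" "pull v v' l0 y \<le> pull v v' l0 x"
    and S: "{a, b, c} \<in> faces K" "fmark K {a, b, c} = {a, b}" and supp: "\<And>u. u \<notin> {a, b, c} \<Longrightarrow> l0 u = 0"
  shows "pull x z (pull x y (pull v v' l0)) = refine_face a b c l0"
proof -
  have nn: "0 \<le> l0 u" for u using l0 by (simp add: bary_def)
  let ?l1 = "pull v v' l0"
  have nn1: "0 \<le> ?l1 u" for u using nn pull_nonneg by blast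
  have rf: "pull x z (pull x y ?l1) = refine_face x y z ?l1"
    using dist by (intro refine_face_ordered[symmetric, OF nn1 _ l0(3)]) (auto simp: p_def)
  have dS: "distinct [a, b, c]" using S(1) by (simp only: faces_def mem_Collect_eq distinct_if_card_3)
  have mids: "midpoint a b \<notin> verts K" "midpoint a c \<notin> verts K" "midpoint b c \<notin> verts K"
  proof -
    obtain e where e: "verts K = {a, b, c, e}"
    proof -
      have "card (verts K - {a, b, c}) = 1"
        using S(1) nd verts by (simp add: faces_def nondeg_def card_Diff_subset)
      then obtain e where "verts K - {a, b, c} = {e}" by (auto simp: card_1_singleton_iff)
      then show ?thesis using that[of e] S(1) by (auto simp: faces_def)
    qed
    then have e': "verts K = {a, c, b, e}" "verts K = {b, c, a, e}" by auto
    have N: "nondeg (verts K)" using wf by (simp add: wf_tet_def)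
    show "midpoint a b \<notin> verts K" "midpoint a c \<notin> verts K" "midpoint b c \<notin> verts K"
      using nondeg_midpoint_notin[OF N[unfolded e]] nondeg_midpoint_notin[OF N[unfolded e'(1)]]
        nondeg_midpoint_notin[OF N[unfolded e'(2)]] by (simp_all only: e[symmetric] e'[symmetric] not_False_eq_True)
  qed
  have sub: "{a, b, c} \<subseteq> verts K" using S(1) by (simp add: faces_def)
  have ms: "c \<noteq> midpoint a b" "b \<noteq> midpoint a c" "a \<noteq> midpoint b c" using mids sub by auto
  obtain c' d' where cd: "{v, c', d'} = {x, y, z}" "distinct [v, c', d']"
    "(v, c', d') \<in> {(x, y, z), (y, x, z), (z, x, y)}"
    using v dist0 by (elim insertE emptyE) auto
  have V: "verts K = {v, v', c', d'}" and dV: "distinct [v, v', c', d']"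
    using verts cd dist0 by auto
  have mF: "z \<noteq> midpoint x y" "y \<noteq> midpoint x z" "c' \<noteq> midpoint v v'" "d' \<noteq> midpoint v v'"
  proof -
    have "c' \<in> {x, y, z}" "d' \<in> {x, y, z}" using cd(1) by auto
    then show "c' \<noteq> midpoint v v'" "d' \<noteq> midpoint v v'" using m_notin by (auto simp: m_def)
    show "z \<noteq> midpoint x y" "y \<noteq> midpoint x z" using n_notin p_notin by (auto simp: n_def p_def)
  qed
  have faceK: "{a, b, c} \<in> {{v, v', c'}, {v, v', d'}, {v, c', d'}, {v', c', d'}}"
    using S(1) faces_eq[OF V dV] by simp
  \<comment> \<open>The refinement faces: \<open>h\<close> is the vertex off the face, so in the
    face \<open>{x, y, z}\<close> of the child only the pull along \<open>{v, g}\<close> survives,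
    whatever the mark of that face is.\<close>
  have ref: ?thesis if g: "{a, b, c} = {v, v', g}" "{v, g, h} = {x, y, z}" "distinct [v, v', g, h]"
    "h \<noteq> midpoint v v'" for g h
  proof -
    have "h \<notin> {a, b, c}" using g by auto
    then have "l0 h = 0" by (rule supp)
    then have "?l1 h = 0" using nn g(4) by (intro pull_zero) auto
    then have 1: "refine_face x y z ?l1 = pull v g ?l1"
    proof (intro refine_face_zero[OF nn1, of _ _ _ h])
      show "{x, y, z} = {h, v, g}" unfolding g(2)[symmetric] by auto
      show "distinct [h, v, g]" "distinct [x, y, z]" using g(3) dist0 by auto
    qed (use mF in auto)
    have "redge K \<subseteq> {a, b, c}" using g redge by auto
    then have "fmark K {a, b, c} = {v, v'}" using wf S(1) redge by (simp add: wf_tet_def)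
    then have ab: "{a, b} = {v, v'}" using S(2) by simp
    have "c = g" using g(1) ab dS by (rule third_vertex_eq)
    then have vm: "v' \<noteq> midpoint v g" "v \<noteq> midpoint v' g"
      using ab ms by (auto simp: doubleton_eq_iff)
    have "refine_face a b c l0 = refine_face v v' g l0"
      using ab refine_face_commute[OF nn vm] \<open>c = g\<close> by (auto simp: doubleton_eq_iff)
    also have "\<dots> = pull v g ?l1"
      by (rule refine_face_ordered[OF nn vm(1) l0(2)])
    finally show ?thesis using rf 1 by simp
  qed
  from faceK have "{a, b, c} = {v, v', c'} \<or> {a, b, c} = {v, v', d'}
    \<or> {a, b, c} = {v, c', d'} \<or> {a, b, c} = {v', c', d'}" by (simp only: insert_iff empty_iff simp_thms)
  then show ?thesis
  proof (elim disjE)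
    assume "{a, b, c} = {v, v', c'}"
    then show ?thesis using ref[of c' d'] cd(1) dV mF by auto
  next
    assume "{a, b, c} = {v, v', d'}"
    then show ?thesis using ref[of d' c'] cd(1) dV mF by (auto simp: insert_commute)
  next
    assume 3: "{a, b, c} = {v, c', d'}"
    then have "v' \<notin> {a, b, c}" using dV by auto
    then have "l0 v' = 0" by (rule supp)
    then have l1: "?l1 = l0" using nn by (intro pull_ineffective) auto
    have F: "{a, b, c} = {x, y, z}" using 3 cd by simp
    then have ab: "{a, b} = {x, y}" using S(2) mark by simp
    then have "c = z" using F dS by (intro third_vertex_eq[of a b c x y z])
    then have "refine_face a b c l0 = refine_face x y z l0"
      using ab refine_face_commute[OF nn ms(2,3)] by (auto simp: doubleton_eq_iff)
    then show ?thesis using rf l1 by simp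
  next
    \<comment> \<open>The face opposite \<open>v\<close>. The point also belongs to the child at
      \<open>v\<close>, so its weight at \<open>v'\<close> vanishes too and it lies on
      \<open>{c', d'}\<close>, where both sides reduce to a single pull.\<close>
    assume 4: "{a, b, c} = {v', c', d'}"
    then have "v \<notin> {a, b, c}" using dV by auto
    then have "l0 v = 0" by (rule supp)
    moreover from this have "l0 v' = 0" using l0(2) nn[of v'] by simp
    ultimately have l1: "?l1 = l0" using nn by (intro pull_ineffective) auto
    have "refine_face x y z l0 = pull c' d' l0"
      using cd(1,2) dist0 mF \<open>l0 v = 0\<close> by (intro refine_face_zero[OF nn, of _ _ _ v]) auto
    moreover have "refine_face a b c l0 = pull c' d' l0"
      using 4 dS dV ms \<open>l0 v' = 0\<close> by (intro refine_face_zero[OF nn, of _ _ _ v']) auto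
    ultimately show ?thesis using rf l1 by simp
  qed
qed

text \<open>A point may lie in several descendants of the same element; its final coordinates do not
  depend on the path chosen, even if the first bisection already separates the two paths.\<close>

lemma bary_same:
  assumes "macro_child K L' v1 v1' x1 y1 z1 w1 w1'"
    and l0: "bary (verts K) l0 q" "l0 v' \<le> l0 v" "pull v v' l0 y \<le> pull v v' l0 x"
    and l0': "l0 v1' \<le> l0 v1" "pull v1 v1' l0 y1 \<le> pull v1 v1' l0 x1"
  shows "pull x z (pull x y (pull v v' l0)) = pull x1 z1 (pull x1 y1 (pull v1 v1' l0))"
proof -
  interpret B: macro_child K L' v1 v1' x1 y1 z1 w1 w1' by fact
  have nn: "0 \<le> l0 u" for u using l0 by (simp add: bary_def)
  let ?l1 = "pull v v' l0" and ?l1' = "pull v1 v1' l0"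
  have nn1: "0 \<le> ?l1 u" "0 \<le> ?l1' u" for u using nn pull_nonneg by blast+
  have rf: "pull x z (pull x y ?l1) = refine_face x y z ?l1"
    using dist by (intro refine_face_ordered[symmetric, OF nn1(1) _ l0(3)]) (auto simp: p_def)
  have rf': "pull x1 z1 (pull x1 y1 ?l1') = refine_face x1 y1 z1 ?l1'"
    using B.dist by (intro refine_face_ordered[symmetric, OF nn1(2) _ l0'(2)]) (auto simp: B.p_def)
  have "{v, v'} = {v1, v1'}" using redge B.redge by simp
  then consider "v = v1" "v' = v1'" | "v = v1'" "v' = v1" by (auto simp: doubleton_eq_iff)
  then show ?thesis
  proof cases
    case 1
    then have F: "{x, y, z} = {x1, y1, z1}"
    proof -
      have "{x, y, z} = verts K - {v'}" using verts dist0 by auto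
      moreover have "{x1, y1, z1} = verts K - {v1'}" using B.verts B.dist0 by auto
      ultimately show ?thesis using 1 by simp
    qed
    then have ab: "{x, y} = {x1, y1}" using mark B.mark by simp
    then have "z = z1" using F dist0 by (intro third_vertex_eq[of x y z x1 y1 z1]) auto
    have ms: "y \<noteq> midpoint x z" "x \<noteq> midpoint y z"
      using dist nondeg_midpoint_notin[of y z x v'] nd by (auto simp: p_def insert_commute)
    have "refine_face x1 y1 z1 ?l1' = refine_face x y z ?l1"
      using ab refine_face_commute[OF nn1(1) ms] \<open>z = z1\<close> 1 by (auto simp: doubleton_eq_iff)
    then show ?thesis using rf rf' by simp
  next
    case 2
    \<comment> \<open>The point lies on the common new face of the two children: the weights at
      \<open>v\<close> and \<open>v'\<close> are equal, the first pull empties both, and on either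
      path only the pull along the opposite edge \<open>{c, d}\<close> is left.\<close>
    have eq: "l0 v = l0 v'" using l0(2) l0'(1) 2 by simp
    have l1: "?l1' = ?l1" using 2 pull_commute by metis
    have z: "?l1 v = 0" "?l1 v' = 0" using eq by (simp_all add: pull_def Let_def)
    obtain c d where cd: "{v, c, d} = {x, y, z}" "distinct [v, c, d]"
      using v dist0 by (elim insertE emptyE) auto
    have vv: "v' \<notin> {x, y, z}" "v \<notin> {x1, y1, z1}" "v \<noteq> v'"
      using dist0 B.dist0 2 v by auto
    have "{x1, y1, z1} = verts K - {v}" using B.verts B.dist0 2 by auto
    also have "\<dots> = {v', c, d}" using verts cd vv by auto
    finally have cd': "{v', c, d} = {x1, y1, z1}" ..
    have "refine_face x y z ?l1 = pull c d ?l1"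
      using cd dist z by (intro refine_face_zero[OF nn1(1), of _ _ _ v]) (auto simp: n_def p_def)
    moreover have "refine_face x1 y1 z1 ?l1' = pull c d ?l1'"
      using cd cd' vv B.dist z unfolding l1
      by (intro refine_face_zero[OF nn1(1), of _ _ _ v']) (auto simp: B.n_def B.p_def)
    ultimately show ?thesis using rf rf' l1 by simp
  qed
qed

end

section \<open>Conformity of the macro meshes\<close>

definition bary_unique :: "marked_tet set \<Rightarrow> bool" where
  "bary_unique U \<longleftrightarrow> (\<forall>K\<in>U. \<forall>L\<in>U. \<forall>l l' x. bary (verts K) l x \<longrightarrow> bary (verts L) l' x \<longrightarrow> l = l')"

text \<open>The invariant of the induction over macro-generations. \<open>inj_on verts\<close>
  excludes two differently marked elements on the same vertices; thus distinct elements share at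
  most three vertices, and a vertex set determines a type.\<close>

definition good_mesh :: "marked_tet set \<Rightarrow> bool" where
  "good_mesh U \<longleftrightarrow> (\<forall>K\<in>U. wf_tet K \<and> \<not> flag K) \<and> bary_unique U \<and> inj_on verts U \<and>
     (\<forall>K\<in>U. \<forall>L\<in>U. \<forall>F\<in>faces K \<inter> faces L. fmark K F = fmark L F)"

definition macro_step :: "marked_tet set \<Rightarrow> marked_tet set" where
  "macro_step U = {K'. \<exists>K\<in>U. \<exists>v v' x y z w w'. macro_child K K' v v' x y z w w'}"

text \<open>
  In a mesh with unique coordinates, the support of a vertex is the vertex alone and the support of
  the midpoint of an edge is that edge.
\<close>

definition support :: "marked_tet set \<Rightarrow> point \<Rightarrow> point set" where
  "support U u = {a. \<exists>K\<in>U. \<exists>l. bary (verts K) l u \<and> 0 < l a}"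

lemma wf_finite: "wf_tet K \<Longrightarrow> finite (verts K)"
  by (metis wf_tet_def nondeg_def card.infinite zero_neq_numeral)

lemma good_meshD:
  assumes "good_mesh U" "K \<in> U"
  shows "wf_tet K" "\<not> flag K" "finite (verts K)" "card (verts K) = 4" "nondeg (verts K)"
proof -
  show w: "wf_tet K" and "\<not> flag K" using assms unfolding good_mesh_def by blast+
  from w show "finite (verts K)" by (rule wf_finite)
  from w show "card (verts K) = 4" "nondeg (verts K)" by (simp_all add: wf_tet_def nondeg_def)
qed

lemma good_mesh_unique:
  "good_mesh U \<Longrightarrow> K \<in> U \<Longrightarrow> L \<in> U \<Longrightarrow> bary (verts K) l x \<Longrightarrow> bary (verts L) l' x \<Longrightarrow> l = l'"
  by (auto simp: good_mesh_def bary_unique_def)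

lemma good_mesh_inj: "good_mesh U \<Longrightarrow> K \<in> U \<Longrightarrow> L \<in> U \<Longrightarrow> verts K = verts L \<Longrightarrow> K = L"
  by (auto simp: good_mesh_def dest: inj_onD)

lemma good_mesh_mark:
  "good_mesh U \<Longrightarrow> K \<in> U \<Longrightarrow> L \<in> U \<Longrightarrow> F \<in> faces K \<Longrightarrow> F \<in> faces L \<Longrightarrow> fmark K F = fmark L F"
  unfolding good_mesh_def by blast

lemma support_eq:
  assumes "good_mesh U" "K \<in> U" "bary (verts K) l u"
  shows "support U u = {a. 0 < l a}"
  using good_mesh_unique[OF assms(1,2) _ assms(3)] assms(2,3) unfolding support_def by blast

lemma bary_vertex:
  assumes "finite V" "a \<in> V"
  shows "bary V (\<lambda>u. if u = a then 1 else 0) a"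
  using assms by (auto simp: bary_def if_distrib [where f = "\<lambda>t. t *\<^sub>R _"] cong: if_cong)

lemma bary_midpoint:
  assumes "finite V" "a \<in> V" "b \<in> V" "a \<noteq> b"
  shows "bary V (\<lambda>u. if u \<in> {a, b} then 1/2 else 0) (midpoint a b)" (is "bary V ?l _")
proof -
  have V: "{a, b} \<subseteq> V" using assms by auto
  have "sum ?l V = sum ?l {a, b}"
    using V assms(1) by (intro sum.mono_neutral_right) auto
  moreover have "(\<Sum>u\<in>V. ?l u *\<^sub>R u) = (\<Sum>u\<in>{a, b}. ?l u *\<^sub>R u)"
    using V assms(1) by (intro sum.mono_neutral_right) auto
  ultimately show ?thesis using assms
    by (auto simp: bary_def midpoint_def scaleR_add_right)
qed

lemma support_vertex:
  assumes "good_mesh U" "K \<in> U" "a \<in> verts K"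
  shows "support U a = {a}"
  using support_eq[OF assms(1,2) bary_vertex[OF good_meshD(3)[OF assms(1,2)] assms(3)]] by auto

lemma support_midpoint:
  assumes "good_mesh U" "K \<in> U" "a \<in> verts K" "b \<in> verts K" "a \<noteq> b"
  shows "support U (midpoint a b) = {a, b}"
  using support_eq[OF assms(1,2) bary_midpoint[OF good_meshD(3)[OF assms(1,2)] assms(3-5)]]
  by (auto split: if_splits)

lemma faces_two_missing:
  assumes "I \<subseteq> V" "card V = 4" "card I \<le> 3"
  obtains S where "I \<subseteq> S" "S \<subseteq> V" "card S = 3"
proof -
  have "finite V" using assms(2) card.infinite by fastforce
  have "\<exists>S. I \<subseteq> S \<and> S \<subseteq> V \<and> card S = 3"
    using exists_subset_between[of I 3 V] assms \<open>finite V\<close> by auto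
  then show ?thesis using that by blast
qed

lemma macro_child_bary_face:
  assumes gm: "good_mesh U" and KU: "K \<in> U" and mc: "macro_child K K' v v' x y z w w'"
    and l: "bary (verts K') l q" and l0: "bary (verts K) l0 q"
    and S: "{a, b, c} \<in> faces K" "fmark K {a, b, c} = {a, b}" and supp: "\<And>u. u \<notin> {a, b, c} \<Longrightarrow> l0 u = 0"
  shows "l = refine_face a b c l0"
proof -
  interpret macro_child K K' v v' x y z w w' by fact
  obtain l1 where l1: "bary (verts K) l1 q" "l1 v' \<le> l1 v" "pull v v' l1 y \<le> pull v v' l1 x"
    "l = pull x z (pull x y (pull v v' l1))"
    using bary_macro_child[OF l] by metis
  have "l1 = l0" using good_mesh_unique[OF gm KU KU l1(1) l0] .
  then show ?thesis using bary_face[OF l0 _ _ S supp] l1 by metis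
qed

lemma face_marked:
  assumes wf: "wf_tet K" and S: "S \<in> faces K"
  obtains a b c where "S = {a, b, c}" "fmark K S = {a, b}" "distinct [a, b, c]"
proof -
  have c3: "card S = 3" and fm: "fmark K S \<subseteq> S" "card (fmark K S) = 2"
    using assms by (auto simp: wf_tet_def faces_def)
  then obtain a b where ab: "fmark K S = {a, b}" "a \<noteq> b" by (auto simp: card_2_iff)
  have "card (S - {a, b}) = 1" using ab fm c3 by (simp add: card_Diff_subset)
  then obtain c where "S - {a, b} = {c}" by (auto simp: card_1_singleton_iff)
  then have "S = {a, b, c}" "distinct [a, b, c]" using ab fm by auto
  then show ?thesis using that ab by blast
qed

lemma face_midpoint_notin:
  assumes wf: "wf_tet K" and S: "{a, b, c} \<in> faces K"
  shows "midpoint a b \<notin> verts K"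
proof -
  have "card (verts K - {a, b, c}) = 1"
    using S wf by (simp add: faces_def nondeg_def wf_tet_def card_Diff_subset)
  then obtain e where "verts K - {a, b, c} = {e}" by (auto simp: card_1_singleton_iff)
  then have e: "verts K = {a, b, c, e}" using S by (auto simp: faces_def)
  show ?thesis using nondeg_midpoint_notin[of a b c e] wf unfolding e wf_tet_def by blast
qed

text \<open>The edge is completed to an arbitrary face of \<open>K\<close>. By
  \<open>refine_face_zero\<close> neither this choice nor the mark of that face is visible in the
  result.\<close>

lemma macro_child_bary_edge:
  assumes gm: "good_mesh U" and KU: "K \<in> U" and mc: "macro_child K K' v v' x y z w w'"
    and l: "bary (verts K') l q" and l0: "bary (verts K) l0 q"
    and e: "{d, e} \<subseteq> verts K" "d \<noteq> e" and supp: "\<And>u. u \<notin> {d, e} \<Longrightarrow> l0 u = 0"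
  shows "l = pull d e l0"
proof -
  have wf: "wf_tet K" and c4: "card (verts K) = 4" using good_meshD[OF gm KU] by blast+
  obtain S where S0: "{d, e} \<subseteq> S" "S \<subseteq> verts K" "card S = 3"
    using faces_two_missing[OF e(1) c4] e(2) by auto
  then have S: "S \<in> faces K" by (simp add: faces_def)
  obtain a b c where abc: "S = {a, b, c}" "fmark K S = {a, b}" "distinct [a, b, c]"
    using face_marked[OF wf S] .
  have "card (S - {d, e}) = 1" using S0 e(2) by (simp add: card_Diff_subset)
  then obtain u where "S - {d, e} = {u}" by (auto simp: card_1_singleton_iff)
  then have u: "S = {u, d, e}" "u \<notin> {d, e}" using S0 by auto
  have nn: "0 \<le> l0 u" for u using l0 by (simp add: bary_def)
  have "l = refine_face a b c l0"
  proof (rule macro_child_bary_face[OF gm KU mc l l0])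
    show "{a, b, c} \<in> faces K" "fmark K {a, b, c} = {a, b}" using S abc by simp_all
    show "l0 u = 0" if "u \<notin> {a, b, c}" for u
    proof (rule supp)
      show "u \<notin> {d, e}" using that S0(1) unfolding abc(1) by blast
    qed
  qed
  also have "\<dots> = pull d e l0"
  proof (rule refine_face_zero[OF nn])
    show "{a, b, c} = {u, d, e}" using u abc by simp
    have ac: "{a, c, b} \<in> faces K" "c \<in> verts K" "b \<in> verts K"
      using S S0 abc(1) by (auto simp: insert_commute)
    show "c \<noteq> midpoint a b" "b \<noteq> midpoint a c"
      using face_midpoint_notin[OF wf ac(1)] face_midpoint_notin[OF wf, of a b c] S abc(1) ac by auto
  qed (use abc u e supp in auto)
  finally show ?thesis .
qed

text \<open>The point is lifted to both parents, where its coordinates agree by the invariant. It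
  remains to see that the two sequences of pulls have the same effect on this one function.\<close>

lemma macro_step_unique:
  assumes gm: "good_mesh U"
  shows "bary_unique (macro_step U)"
  unfolding bary_unique_def
proof (intro ballI allI impI)
  fix K' L' l l' q
  assume K': "K' \<in> macro_step U" and L': "L' \<in> macro_step U"
    and l: "bary (verts K') l q" and l': "bary (verts L') l' q"
  obtain K v v' x y z w w' where KU: "K \<in> U" and mK: "macro_child K K' v v' x y z w w'"
    using K' by (auto simp: macro_step_def)
  obtain L v1 v1' x1 y1 z1 w1 w1' where LU: "L \<in> U" and mL: "macro_child L L' v1 v1' x1 y1 z1 w1 w1'"
    using L' by (auto simp: macro_step_def)
  interpret A: macro_child K K' v v' x y z w w' by fact
  interpret B: macro_child L L' v1 v1' x1 y1 z1 w1 w1' by fact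
  obtain l0 where l0: "bary (verts K) l0 q" "l0 v' \<le> l0 v" "pull v v' l0 y \<le> pull v v' l0 x"
    "l = pull x z (pull x y (pull v v' l0))"
    using A.bary_macro_child[OF l] by metis
  obtain l0' where l0': "bary (verts L) l0' q" "l0' v1' \<le> l0' v1" "pull v1 v1' l0' y1 \<le> pull v1 v1' l0' x1"
    "l' = pull x1 z1 (pull x1 y1 (pull v1 v1' l0'))"
    using B.bary_macro_child[OF l'] by metis
  have eq: "l0' = l0" using good_mesh_unique[OF gm LU KU l0'(1) l0(1)] .
  have l0L: "bary (verts L) l0 q" using l0'(1) eq by simp
  show "l = l'"
  proof (cases "K = L")
    case True
    then show ?thesis using A.bary_same[OF mL[folded True] l0(1-3)] l0' l0(4) eq by simp
  next
    case False
    \<comment> \<open>\<open>l0\<close> is a coordinate function for both \<open>K\<close> and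
      \<open>L\<close>, so it vanishes off both vertex sets. The point lies on their common subface,
      and its size decides which description of the pulls applies.\<close>
    define I where "I = verts K \<inter> verts L"
    have supp: "l0 u = 0" if "u \<notin> I" for u
      using that l0(1) l0L by (auto simp: bary_def I_def)
    have c4: "card (verts K) = 4" "card (verts L) = 4" and fin: "finite (verts K)" "finite (verts L)"
      using good_meshD[OF gm] KU LU by blast+
    have I: "I \<subseteq> verts K" "I \<subseteq> verts L" by (auto simp: I_def)
    have "I \<noteq> verts K \<or> I \<noteq> verts L" using good_mesh_inj[OF gm KU LU] False by blast
    then have "card I < 4" using I fin c4 psubset_card_mono by (metis psubsetI)
    then consider "card I = 3" | "card I = 2" | "card I = 1" | "card I = 0" by linarith
    then show ?thesis
    proof cases
      case 1
      then have F: "I \<in> faces K" "I \<in> faces L" using I by (auto simp: faces_def)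
      obtain a b c where abc: "I = {a, b, c}" "fmark K I = {a, b}"
        using face_marked[OF A.wf F(1)] by metis
      have m: "fmark L I = {a, b}" using good_mesh_mark[OF gm KU LU F] abc by simp
      show ?thesis
        using macro_child_bary_face[OF gm KU mK l l0(1), of a b c]
          macro_child_bary_face[OF gm LU mL l' l0L, of a b c] abc m F supp by simp
    next
      case 2
      then obtain d e where de: "I = {d, e}" "d \<noteq> e" by (auto simp: card_2_iff)
      show ?thesis
        using macro_child_bary_edge[OF gm KU mK l l0(1), of d e]
          macro_child_bary_edge[OF gm LU mL l' l0L, of d e] de supp I by simp
    next
      case 3
      then obtain d where d: "I = {d}" by (auto simp: card_1_singleton_iff)
      have nn: "0 \<le> l0 u" for u using l0 by (simp add: bary_def)
      have "\<exists>e. e \<in> V \<and> e \<noteq> d" if "card V = 4" for V :: "point set"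
      proof (rule ccontr)
        assume "\<not> ?thesis"
        then have "V \<subseteq> {d}" by auto
        then have "card V \<le> 1" using card_mono[of "{d}" V] by simp
        then show False using that by simp
      qed
      \<comment> \<open>At a single common vertex each element gets an auxiliary edge through
        \<open>d\<close>; its pull is void because the other endpoint has weight zero.\<close>
      then obtain e e' where e: "e \<in> verts K" "e \<noteq> d" "e' \<in> verts L" "e' \<noteq> d" using c4 by metis
      have "l0 e = 0" "l0 e' = 0" using supp d e by auto
      then have "pull d e l0 = l0" "pull d e' l0 = l0" using nn by (auto intro: pull_ineffective)
      then show ?thesis
        using macro_child_bary_edge[OF gm KU mK l l0(1), of d e]
          macro_child_bary_edge[OF gm LU mL l' l0L, of d e'] d e supp I by auto
    next
      case 4
      then have "I = {}" using fin I by (metis card_eq_0_iff finite_subset)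
      then have "sum l0 (verts K) = 0" using supp by simp
      then show ?thesis using l0(1) by (simp add: bary_def)
    qed
  qed
qed

text \<open>At the barycentre of the child every inequality met on the way up is strict. The
  coordinates then reveal the parent as their positivity set, and after it the kept endpoints
  \<open>v\<close>, \<open>x\<close> and \<open>w\<close> in turn.\<close>

lemma macro_step_inj:
  assumes gm: "good_mesh U"
  shows "inj_on verts (macro_step U)"
proof (rule inj_onI)
  fix K' L'
  assume K': "K' \<in> macro_step U" and L': "L' \<in> macro_step U" and V: "verts K' = verts L'"
  obtain K v v' x y z w w' where KU: "K \<in> U" and mK: "macro_child K K' v v' x y z w w'"
    using K' by (auto simp: macro_step_def)
  obtain L v1 v1' x1 y1 z1 w1 w1' where LU: "L \<in> U" and mL: "macro_child L L' v1 v1' x1 y1 z1 w1 w1'"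
    using L' by (auto simp: macro_step_def)
  interpret A: macro_child K K' v v' x y z w w' by fact
  interpret B: macro_child L L' v1 v1' x1 y1 z1 w1 w1' by fact
  \<comment> \<open>Equal weights on four vertices: \<open>q\<close> is the barycentre.\<close>
  define l where "l u = (if u \<in> verts K' then 1/4 else 0 :: real)" for u
  define q where "q = (\<Sum>u\<in>verts K'. l u *\<^sub>R u)"
  have c4: "card (verts K') = 4" using A.wf_K' by (simp add: wf_tet_def nondeg_def)
  have l: "bary (verts K') l q" unfolding bary_def q_def using c4 by (simp add: l_def)
  have l': "bary (verts L') l q" using l V by simp
  have pos: "\<forall>u\<in>verts K'. 0 < l u" "\<forall>u\<in>verts L'. 0 < l u" using V by (auto simp: l_def)
  obtain l0 where l0: "bary (verts K) l0 q"
    "(\<forall>u\<in>verts K. 0 < l0 u) \<and> l0 v' < l0 v \<and>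
       pull v v' l0 y < pull v v' l0 x \<and> pull x y (pull v v' l0) w' < pull x y (pull v v' l0) w"
    using A.bary_macro_child[OF l] pos by metis
  obtain l0' where l0': "bary (verts L) l0' q"
    "(\<forall>u\<in>verts L. 0 < l0' u) \<and> l0' v1' < l0' v1 \<and>
       pull v1 v1' l0' y1 < pull v1 v1' l0' x1 \<and> pull x1 y1 (pull v1 v1' l0') w1' < pull x1 y1 (pull v1 v1' l0') w1"
    using B.bary_macro_child[OF l'] pos by metis
  have eq: "l0' = l0" using good_mesh_unique[OF gm LU KU l0'(1) l0(1)] .
  have "verts K = {u. 0 < l0 u}" if "bary (verts K) l0 q" "\<forall>u\<in>verts K. 0 < l0 u" for K
    using that unfolding bary_def by (metis (mono_tags, lifting) Collect_cong Collect_mem_eq less_irrefl)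
  then have "verts K = verts L" using l0 l0' eq by metis
  then have KL: "K = L" using good_mesh_inj[OF gm KU LU] by blast
  have "{v, v'} = {v1, v1'}" using A.redge B.redge KL by simp
  then have v: "v = v1" "v' = v1'" using l0(2) l0'(2) eq by (auto simp: doubleton_eq_iff)
  have "{x, y, z} = verts K - {v'}" using A.verts A.dist0 by auto
  moreover have "{x1, y1, z1} = verts L - {v1'}" using B.verts B.dist0 by auto
  ultimately have F: "{x, y, z} = {x1, y1, z1}" using v KL by simp
  then have xy: "{x, y} = {x1, y1}" using A.mark B.mark KL by simp
  then have x: "x = x1" "y = y1" using l0(2) l0'(2) eq v by (auto simp: doubleton_eq_iff)
  have "z = z1" using F xy A.dist0 by (intro third_vertex_eq[of x y z x1 y1 z1]) auto
  then have "{w, w'} = {w1, w1'}" using A.w_dist(4) B.w_dist(4) x by simp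
  then have "w = w1" using l0(2) l0'(2) eq v x by (auto simp: doubleton_eq_iff)
  then show "K' = L'" using A.K' B.K' KL v x by simp
qed

section \<open>Compatibility of the face marks\<close>

context macro_child
begin

lemma support_facts:
  assumes "good_mesh U" "K \<in> U"
  shows "support U w = {w}" "support U p = {x, z}" "support U n = {x, y}" "support U m = {v, v'}"
proof -
  note sm = support_midpoint[OF assms] and sv = support_vertex[OF assms]
  show "support U w = {w}" using w by (intro sv) (auto simp: verts)
  show "support U p = {x, z}" unfolding p_def using dist0 by (intro sm) (auto simp: verts)
  show "support U n = {x, y}" unfolding n_def using dist0 by (intro sm) (auto simp: verts)
  show "support U m = {v, v'}"
    unfolding m_def using dist0 v by (intro sm) (auto simp: verts)
qed

lemma old_vertices:
  assumes "good_mesh U" "K \<in> U"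
  shows "{u \<in> {w, p, n}. support U u = {u}} = {w}" "{u \<in> {w, p, m}. support U u = {u}} = {w}"
    "{u \<in> {w, n, m}. support U u = {u}} = {w}" "{u \<in> {p, n, m}. support U u = {u}} = {}"
proof -
  have "support U p \<noteq> {p}" "support U n \<noteq> {n}" "support U m \<noteq> {m}"
    using support_facts[OF assms] dist0 v by auto
  then show "{u \<in> {w, p, n}. support U u = {u}} = {w}" "{u \<in> {w, p, m}. support U u = {u}} = {w}"
    "{u \<in> {w, n, m}. support U u = {u}} = {w}" "{u \<in> {p, n, m}. support U u = {u}} = {}"
    using support_facts(1)[OF assms] by auto
qed

text \<open>A child face inside a face \<open>S\<close> of the parent is marked by joining its old
  vertex to the midpoint of the mark of \<open>S\<close>. Nothing else about the parent enters, so
  neighbours that agree on \<open>S\<close> agree here. The face \<open>{p, n, m}\<close> cannot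
  occur, since the supports of its vertices involve all vertices of \<open>K\<close>.\<close>

lemma fmark_on_face:
  assumes gm: "good_mesh U" "K \<in> U" and S: "S \<in> faces K" and F: "F' \<in> faces K'"
    and sub: "\<And>u. u \<in> F' \<Longrightarrow> support U u \<subseteq> S"
  shows "fmark K' F' = insert (emid (fmark K S)) {u \<in> F'. support U u = {u}}"
proof -
  note sf = support_facts[OF gm] and ov = old_vertices[OF gm]
  have S': "card S = 3" "S \<subseteq> verts K" using S by (auto simp: faces_def)
  then have "finite S" using wf wf_finite finite_subset by blast
  have not4: "\<not> {v', x, y, z} \<subseteq> S"
    using card_mono[OF \<open>finite S\<close>, of "{v', x, y, z}"] dist0 S' by auto
  have ref: "fmark K S = {v, v'}" if "{v, v'} \<subseteq> S"
    using that wf S redge by (simp add: wf_tet_def)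
  have "F' = {w, p, n} \<or> F' = {w, p, m} \<or> F' = {w, n, m} \<or> F' = {p, n, m}"
    using F unfolding faces_K' by (simp only: insert_iff empty_iff simp_thms)
  then show ?thesis
  proof (elim disjE)
    assume F': "F' = {w, p, n}"
    then have "{x, y, z} \<subseteq> S" using sub[of p] sub[of n] sf by auto
    then have "{x, y, z} = S" using \<open>finite S\<close> S' dist0 by (intro card_subset_eq) auto
    then have "fmark K S = {x, y}" using mark by simp
    then have "emid (fmark K S) = n" by (simp add: n_def)
    then show ?thesis unfolding F' ov K'_facts by auto
  next
    assume F': "F' = {w, p, m}"
    then have "{v, v'} \<subseteq> S" using sub[of m] sf by auto
    then have "emid (fmark K S) = m" using ref by (simp add: m_def)
    then show ?thesis unfolding F' ov K'_facts by auto
  next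
    assume F': "F' = {w, n, m}"
    then have *: "{v, v'} \<subseteq> S" "w \<in> S" "x \<in> S" "y \<in> S"
      using sub[of m] sub[of w] sub[of n] sf by auto
    then have "w \<noteq> z" using not4 by auto
    then have "fmark K' {w, n, m} = {w, m}" by (simp add: K'_facts)
    moreover have "emid (fmark K S) = m" using ref * by (simp add: m_def)
    ultimately show ?thesis unfolding F' ov by auto
  next
    assume F': "F' = {p, n, m}"
    then have "{v', x, y, z} \<subseteq> S" using sub[of m] sub[of p] sub[of n] sf by auto
    then show ?thesis using not4 by simp
  qed
qed

text \<open>The right-hand side depends on the child only through the vertex set of the face.\<close>

lemma fmark_inside:
  assumes gm: "good_mesh U" "K \<in> U" and F: "F' \<in> faces K'"
  shows "fmark K' F' =
    (let m = emid (redge K); V = {u \<in> F'. support U u = {u}};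
         X = \<Union> (support U ` (F' - {m})); n = emid (fmark K X)
     in if m \<notin> F' then insert n V
        else if V = {} then if tet_type K = Type_Pu then {n, m} else F' - {n}
        else if tet_type K = Type_Pu \<and> card X = 3 then insert n V else insert m V)"
proof -
  note sf = support_facts[OF gm] and ov = old_vertices[OF gm]
  have m: "emid (redge K) = m" by (simp add: redge m_def)
  have n: "emid (fmark K {x, y, z}) = n" by (simp add: mark n_def)
  have c: "card {x, y, z} = 3" "card {x, y} = 2" "card {x, z} = 2" using dist0 by auto
  have "F' = {w, p, n} \<or> F' = {w, p, m} \<or> F' = {w, n, m} \<or> F' = {p, n, m}"
    using F unfolding faces_K' by (simp only: insert_iff empty_iff simp_thms)
  then show ?thesis
  proof (elim disjE)
    assume F': "F' = {w, p, n}"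
    have "F' - {m} = {w, p, n}" using F' dist_K' by auto
    then have "\<Union> (support U ` (F' - {m})) = {x, y, z}" using sf w by auto
    moreover have "m \<notin> F'" using F' dist_K' by auto
    ultimately show ?thesis using F' ov n by (auto simp: Let_def m K'_facts)
  next
    assume F': "F' = {w, p, m}"
    have "F' - {m} = {w, p}" using F' dist_K' by auto
    then have "\<Union> (support U ` (F' - {m})) = {x, z}" using sf w by auto
    then show ?thesis using F' ov c by (auto simp: Let_def m K'_facts)
  next
    assume F': "F' = {w, n, m}"
    have "F' - {m} = {w, n}" using F' dist_K' by auto
    then have X: "\<Union> (support U ` (F' - {m})) = (if w = z then {x, y, z} else {x, y})" using sf w by auto
    show ?thesis using F' ov c n unfolding m Let_def X by (auto simp: K'_facts)
  next
    assume F': "F' = {p, n, m}"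
    have "F' - {m} = {p, n}" using F' dist_K' by auto
    then have X: "\<Union> (support U ` (F' - {m})) = {x, y, z}" using sf by auto
    have "F' - {n} = {p, m}" using F' dist_K' by auto
    then show ?thesis using F' ov n unfolding m Let_def X by (auto simp: K'_facts)
  qed
qed

lemma support_subset:
  assumes gm: "good_mesh U" "K \<in> U" and "u \<in> verts K'"
  shows "support U u \<subseteq> verts K"
  using assms(3) support_facts[OF gm] w v by (auto simp: K'_facts(1) verts)

text \<open>A face of the child cannot lie in an edge of the parent. If two parents share a child
  face, they must therefore share at least three vertices.\<close>

lemma support_face_card:
  assumes gm: "good_mesh U" "K \<in> U" and F: "F' \<in> faces K'"
    and sub: "\<And>u. u \<in> F' \<Longrightarrow> support U u \<subseteq> I" and "finite I"
  shows "3 \<le> card I"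
proof -
  note sf = support_facts[OF gm]
  have "F' = {w, p, n} \<or> F' = {w, p, m} \<or> F' = {w, n, m} \<or> F' = {p, n, m}"
    using F unfolding faces_K' by (simp only: insert_iff empty_iff simp_thms)
  then have "{x, y, z} \<subseteq> I \<or> {x, z, v'} \<subseteq> I \<or> {x, y, v'} \<subseteq> I"
    using sub[of w] sub[of p] sub[of n] sub[of m] sf by (elim disjE) auto
  moreover have "card {x, y, z} = 3" "card {x, z, v'} = 3" "card {x, y, v'} = 3" using dist0 by auto
  ultimately show ?thesis using card_mono[OF \<open>finite I\<close>] by metis
qed

end

text \<open>With one parent the formula of \<open>fmark_inside\<close> applies on both sides. Two
  different parents share at most three vertices by the invariant and at least three by
  \<open>support_face_card\<close>, hence a full face, whose mark is common.\<close>

lemma macro_step_mark: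
  assumes gm: "good_mesh U" and K': "K' \<in> macro_step U" and L': "L' \<in> macro_step U"
    and F: "F' \<in> faces K'" "F' \<in> faces L'"
  shows "fmark K' F' = fmark L' F'"
proof -
  obtain K v v' x y z w w' where KU: "K \<in> U" and mK: "macro_child K K' v v' x y z w w'"
    using K' by (auto simp: macro_step_def)
  obtain L v1 v1' x1 y1 z1 w1 w1' where LU: "L \<in> U" and mL: "macro_child L L' v1 v1' x1 y1 z1 w1 w1'"
    using L' by (auto simp: macro_step_def)
  interpret A: macro_child K K' v v' x y z w w' by fact
  interpret B: macro_child L L' v1 v1' x1 y1 z1 w1 w1' by fact
  show ?thesis
  proof (cases "K = L")
    case True
    show ?thesis unfolding A.fmark_inside[OF gm KU F(1)] B.fmark_inside[OF gm LU F(2)] True ..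
  next
    case False
    define I where "I = verts K \<inter> verts L"
    have sub: "support U u \<subseteq> I" if "u \<in> F'" for u
    proof -
      have "u \<in> verts K'" "u \<in> verts L'" using F that by (auto simp: faces_def)
      then show ?thesis
        using A.support_subset[OF gm KU] B.support_subset[OF gm LU] by (simp add: I_def)
    qed
    have c4: "card (verts K) = 4" "card (verts L) = 4" and fin: "finite (verts K)" "finite (verts L)"
      using good_meshD[OF gm] KU LU by blast+
    have I: "I \<subseteq> verts K" "I \<subseteq> verts L" "finite I" using fin by (auto simp: I_def)
    have "I \<noteq> verts K \<or> I \<noteq> verts L" using good_mesh_inj[OF gm KU LU] False by blast
    then have "card I < 4" using I fin c4 psubset_card_mono by (metis psubsetI)
    moreover have "3 \<le> card I" using A.support_face_card[OF gm KU F(1) sub I(3)] .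
    ultimately have IF: "I \<in> faces K" "I \<in> faces L" using I by (auto simp: faces_def)
    have "fmark K I = fmark L I" using good_mesh_mark[OF gm KU LU IF] .
    then show ?thesis
      using A.fmark_on_face[OF gm KU IF(1) F(1) sub] B.fmark_on_face[OF gm LU IF(2) F(2) sub] by simp
  qed
qed

lemma good_mesh_step:
  assumes gm: "good_mesh U"
  shows "good_mesh (macro_step U)"
proof -
  have "wf_tet K' \<and> \<not> flag K'" if "K' \<in> macro_step U" for K'
  proof -
    obtain K v v' x y z w w' where mK: "macro_child K K' v v' x y z w w'"
      using \<open>K' \<in> macro_step U\<close> unfolding macro_step_def by blast
    interpret macro_child K K' v v' x y z w w' by fact
    show ?thesis using wf_K' K'_facts by simp
  qed
  moreover have "\<forall>K\<in>macro_step U. \<forall>L\<in>macro_step U. \<forall>F\<in>faces K \<inter> faces L. fmark K F = fmark L F"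
    using macro_step_mark[OF gm] by blast
  ultimately show ?thesis
    unfolding good_mesh_def using macro_step_unique[OF gm] macro_step_inj[OF gm] by blast
qed

lemma macro_step_type:
  assumes "K' \<in> macro_step U"
  shows "tet_type K' = Type_A \<or> tet_type K' = Type_Pu"
proof -
  obtain K v v' x y z w w' where mK: "macro_child K K' v v' x y z w w'"
    using assms unfolding macro_step_def by blast
  interpret macro_child K K' v v' x y z w w' by fact
  show ?thesis using K'_type by simp
qed

section \<open>Macro steps as three uniform bisections; the initial mesh\<close>

lemma bisect_all_self: "bisect_all T T = \<Union> (children ` T)"
  by (simp add: bisect_all_def)

lemma macro_step_eq:
  assumes "good_mesh U"
  shows "((\<lambda>T. bisect_all T T) ^^ 3) U = macro_step U"
proof
  show "((\<lambda>T. bisect_all T T) ^^ 3) U \<subseteq> macro_step U"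
  proof
    fix K' assume "K' \<in> ((\<lambda>T. bisect_all T T) ^^ 3) U"
    then obtain K v x w where *: "K \<in> U" "v \<in> redge K" "x \<in> redge (child K v)"
      "w \<in> redge (child (child K v) x)" "K' = child (child (child K v) x) w"
      by (auto simp: bisect_all_self children_def numeral_3_eq_3)
    obtain v' y z w' where "macro_child K K' v v' x y z w w'"
      using macro_child_exists[OF good_meshD(1,2)[OF assms *(1)] *(2-4)] *(5) by metis
    then show "K' \<in> macro_step U" using *(1) unfolding macro_step_def by blast
  qed
  show "macro_step U \<subseteq> ((\<lambda>T. bisect_all T T) ^^ 3) U"
  proof
    fix K' assume "K' \<in> macro_step U"
    then obtain K v v' x y z w w' where KU: "K \<in> U" and mK: "macro_child K K' v v' x y z w w'"
      by (auto simp: macro_step_def)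
    interpret macro_child K K' v v' x y z w w' by fact
    have "v \<in> redge K" "x \<in> redge D" "w \<in> redge G"
      using redge D_facts(2) G_facts(2) w by auto
    then show "K' \<in> ((\<lambda>T. bisect_all T T) ^^ 3) U"
      using KU unfolding K' D_def G_def
      by (auto simp: bisect_all_self children_def numeral_3_eq_3)
  qed
qed

lemma bary_mono:
  assumes "bary S l x" "S \<subseteq> V" "finite V"
  shows "bary V l x"
proof -
  have z: "\<forall>u\<in>V - S. l u = 0" using assms(1) by (simp add: bary_def)
  have "sum l V = sum l S" using assms(2,3) z by (intro sum.mono_neutral_right)
  moreover have "(\<Sum>u\<in>V. l u *\<^sub>R u) = (\<Sum>u\<in>S. l u *\<^sub>R u)"
    using assms(2,3) z by (intro sum.mono_neutral_right) auto
  ultimately show ?thesis using assms by (auto simp: bary_def)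
qed

lemma bary_in_hull: "finite V \<Longrightarrow> bary V l x \<Longrightarrow> x \<in> convex hull V"
  by (auto simp: bary_def convex_hull_finite)

lemma in_hull_bary:
  assumes "finite V" "x \<in> convex hull V"
  obtains l where "bary V l x"
proof -
  obtain l where l: "\<forall>u\<in>V. 0 \<le> l u" "sum l V = 1" "(\<Sum>u\<in>V. l u *\<^sub>R u) = x"
    using assms by (auto simp: convex_hull_finite)
  have "bary V (\<lambda>u. if u \<in> V then l u else 0) x"
    using l by (auto simp: bary_def cong: if_cong sum.cong)
  then show ?thesis using that by blast
qed

text \<open>For distinct elements the common point lies in the hull of their common vertices; its
  coordinates there, extended by zero, serve both elements. Two elements on the same vertices would
  share a nonempty interior.\<close>

lemma good_mesh_initial:
  assumes "initial_amp_mesh \<Omega> T0"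
  shows "good_mesh T0"
proof -
  have cm: "amp_mesh \<Omega> T0" "conforming T0"
      "\<forall>K\<in>T0. \<forall>L\<in>T0. \<forall>F\<in>faces K \<inter> faces L. fmark K F = fmark L F"
    and uf: "\<forall>K\<in>T0. \<not> flag K"
    using assms unfolding initial_amp_mesh_def conformingly_marked_def by - (elim conjE, assumption)+
  have im: "\<forall>K\<in>T0. is_marked_tet K"
    and disj: "\<forall>K\<in>T0. \<forall>L\<in>T0. K \<noteq> L \<longrightarrow> interior (body K) \<inter> interior (body L) = {}"
    using cm(1) unfolding amp_mesh_def by - (elim conjE, assumption)+
  have wf: "wf_tet K" if "K \<in> T0" for K
    using im that by (simp add: is_marked_tet_def wf_tet_def nondeg_def)
  have "bary_unique T0"
    unfolding bary_unique_def
  proof (intro ballI allI impI)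
    fix K L l l' x
    assume KL: "K \<in> T0" "L \<in> T0" and l: "bary (verts K) l x" and l': "bary (verts L) l' x"
    have nd: "nondeg (verts K)" "nondeg (verts L)" and fin: "finite (verts K)" "finite (verts L)"
      using wf KL wf_finite by (auto simp: wf_tet_def)
    show "l = l'"
    proof (cases "K = L")
      case True
      then show ?thesis using nondeg_bary_unique[OF nd(1) l] l' by simp
    next
      case False
      then obtain S where S: "S \<subseteq> verts K" "S \<subseteq> verts L" "body K \<inter> body L = convex hull S"
        using cm(2)[unfolded conforming_def, rule_format, OF KL False] by blast
      have "x \<in> convex hull S"
        using bary_in_hull[OF fin(1) l] bary_in_hull[OF fin(2) l'] S(3) by (auto simp: body_def)
      then obtain l2 where l2: "bary S l2 x" using in_hull_bary S(1) fin(1) finite_subset by metis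
      then have "bary (verts K) l2 x" "bary (verts L) l2 x" using bary_mono S fin by blast+
      then show ?thesis using nondeg_bary_unique nd l l' by metis
    qed
  qed
  moreover have "inj_on verts T0"
  proof (rule inj_onI, rule ccontr)
    fix K L assume KL: "K \<in> T0" "L \<in> T0" "verts K = verts L" "K \<noteq> L"
    then have "interior (body K) = {}" using disj by (metis body_def inf.idem)
    moreover have "card (verts K) = Suc DIM(point)" "\<not> affine_dependent (verts K)"
      using wf[OF KL(1)] by (simp_all add: wf_tet_def nondeg_def)
    ultimately show False using interior_convex_hull_eq_empty[of "verts K"] by (simp add: body_def)
  qed
  ultimately show ?thesis unfolding good_mesh_def using wf uf cm(3) by blast
qed

lemma good_mesh_macro:
  assumes "initial_amp_mesh \<Omega> T0"
  shows "good_mesh (macro_mesh T0 q) \<and> macro_mesh T0 (Suc q) = macro_step (macro_mesh T0 q)"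
proof (induction q)
  case 0
  show ?case
    using good_mesh_initial[OF assms] macro_step_eq by (simp add: macro_mesh_def)
next
  case (Suc q)
  then have gm: "good_mesh (macro_mesh T0 (Suc q))" using good_mesh_step by simp
  have "macro_mesh T0 (Suc (Suc q)) = ((\<lambda>T. bisect_all T T) ^^ 3) (macro_mesh T0 (Suc q))"
  proof -
    have "3 * Suc (Suc q) = 3 + 3 * Suc q" by simp
    then show ?thesis unfolding macro_mesh_def by (simp only: funpow_add o_apply)
  qed
  then show ?case using gm macro_step_eq by simp
qed

section \<open>Edge classes and macro-generations\<close>

lemma edge_doubleton:
  assumes "e \<in> edges K"
  obtains a b where "e = {a, b}" "a \<noteq> b" "a \<in> verts K" "b \<in> verts K"
  using assms by (auto simp: edges_def card_2_iff)

lemma support_edge: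
  assumes "good_mesh U" "e \<in> mesh_edges U"
  shows "support U (emid e) = e"
proof -
  obtain K where K: "K \<in> U" "e \<in> edges K" using assms(2) by (auto simp: mesh_edges_def)
  obtain a b where "e = {a, b}" "a \<noteq> b" "a \<in> verts K" "b \<in> verts K"
    using edge_doubleton[OF K(2)] .
  then show ?thesis using support_midpoint[OF assms(1) K(1)] by simp
qed

lemma emid_not_vertex:
  assumes "good_mesh U" "e \<in> mesh_edges U"
  shows "emid e \<notin> mesh_verts U"
proof
  assume "emid e \<in> mesh_verts U"
  then have "support U (emid e) = {emid e}"
    using support_vertex[OF assms(1)] by (auto simp: mesh_verts_def)
  then have "card e = card {emid e}" using support_edge[OF assms] by simp
  moreover have "card e = 2" using assms(2) by (auto simp: mesh_edges_def edges_def)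
  ultimately show False by simp
qed

text \<open>The endpoints have supports \<open>{a}\<close>, \<open>{a, b}\<close> for H;
  \<open>{c}\<close>, \<open>{a, b}\<close> for V; \<open>{a, b}\<close>, \<open>{a, c}\<close> for
  the midlines; and two opposite edges for the inner classes. Union and intersection separate these
  patterns, except the two inner classes, for which the union is a vertex set that determines the
  element and its type.\<close>

lemma has_cls_support:
  assumes gm: "good_mesh U" and "has_cls U e c"
  defines "X \<equiv> \<Union> (support U ` e)" and "Y \<equiv> \<Inter> (support U ` e)"
  shows "c = Cls_H \<and> card X = 2 \<or> c = Cls_V \<and> card X = 3 \<and> Y = {} \<or> c = Cls_Mf \<and> card X = 3 \<and> Y \<noteq> {} \<or>
    card X = 4 \<and> (\<exists>K\<in>U. verts K = X \<and>
      (c = Cls_IA \<and> tet_type K = Type_A \<or> c = Cls_IP \<and> tet_type K = Type_Pu))"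
proof -
  have I: "support U ` {emid (redge K), emid (verts K - redge K)} = {redge K, verts K - redge K}
      \<and> redge K \<union> (verts K - redge K) = verts K \<and> card (verts K) = 4" if K: "K \<in> U" for K
  proof -
    have wf: "wf_tet K" and c4: "card (verts K) = 4" using good_meshD[OF gm K] by blast+
    have r: "redge K \<in> edges K" using wf by (simp add: wf_tet_def)
    then have r': "redge K \<subseteq> verts K" "card (redge K) = 2" by (auto simp: edges_def)
    have "card (verts K - redge K) = 2"
      using r' c4 wf_finite[OF wf] by (simp add: card_Diff_subset finite_subset)
    then have "verts K - redge K \<in> edges K" by (simp add: edges_def)
    then show ?thesis
      using support_edge[OF gm] r r' c4 K by (auto simp: mesh_edges_def)
  qed
  from assms(2) show ?thesis
  proof cases
    case (H K a b)
    then have ab: "a \<noteq> b" "a \<in> verts K" "b \<in> verts K" by (auto simp: edges_def)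
    have "support U ` e = {{a}, {a, b}}"
      using H support_vertex[OF gm, of K a] support_midpoint[OF gm, of K a b] ab by simp
    then have "X = {a, b}" by (auto simp: X_def)
    then show ?thesis using H ab by simp
  next
    case (V K a b c)
    then have d: "distinct [a, b, c]" "a \<in> verts K" "b \<in> verts K" "c \<in> verts K"
      using distinct_if_card_3[of a b c] by (auto simp: faces_def)
    have "support U ` e = {{c}, {a, b}}"
      using V support_vertex[OF gm, of K c] support_midpoint[OF gm, of K a b] d by simp
    then show ?thesis using V d by (simp add: X_def Y_def)
  next
    case (Mf K a b c)
    then have d: "distinct [a, b, c]" "a \<in> verts K" "b \<in> verts K" "c \<in> verts K"
      using distinct_if_card_3[of a b c] by (auto simp: faces_def)
    have "support U ` e = {{a, b}, {a, c}}"
      using Mf support_midpoint[OF gm, of K a b] support_midpoint[OF gm, of K a c] d by simp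
    then have "X = {a, b, c}" "Y \<noteq> {}" by (auto simp: X_def Y_def)
    then show ?thesis using Mf d by simp
  next
    case (IA K)
    then have "X = verts K" "card X = 4" using I[OF IA(3)] by (simp_all add: X_def)
    then show ?thesis using IA by auto
  next
    case (IP K)
    then have "X = verts K" "card X = 4" using I[OF IP(3)] by (simp_all add: X_def)
    then show ?thesis using IP by auto
  qed
qed

lemma has_cls_unique:
  assumes gm: "good_mesh U" and "has_cls U e c" "has_cls U e c'"
  shows "c = c'"
proof (rule ccontr)
  assume ne: "c \<noteq> c'"
  define X where "X = \<Union> (support U ` e)"
  note A = has_cls_support[OF gm assms(2), folded X_def]
    and B = has_cls_support[OF gm assms(3), folded X_def]
  have "card X = 4" using A B ne by auto
  then obtain K L where "K \<in> U" "verts K = X" "L \<in> U" "verts L = X"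
    and t: "c = Cls_IA \<and> tet_type K = Type_A \<or> c = Cls_IP \<and> tet_type K = Type_Pu"
      "c' = Cls_IA \<and> tet_type L = Type_A \<or> c' = Cls_IP \<and> tet_type L = Type_Pu"
    using A B by auto
  then have "K = L" using good_mesh_inj[OF gm] by metis
  then show False using t ne by auto
qed

lemma The_cls:
  assumes "good_mesh U" "has_cls U e c"
  shows "(THE c. has_cls U e c) = c"
  using has_cls_unique[OF assms(1)] assms(2) by blast

lemma macro_child_start:
  assumes wf: "wf_tet K" and uf: "\<not> flag K" and v: "v \<in> redge K"
  obtains v' x y z where "macro_child K (child (child (child K v) x) x) v v' x y z x z"
proof -
  obtain a b where "redge K = {a, b}" "a \<noteq> b" "a \<in> verts K" "b \<in> verts K"
    using wf edge_doubleton[of "redge K"] by (auto simp: wf_tet_def)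
  then obtain v' where r: "redge K = {v, v'}" "v \<noteq> v'" "v \<in> verts K" "v' \<in> verts K"
    using v by (metis insert_commute insertE singletonD)
  have "card (verts K - {v'}) = 3" using wf r by (simp add: wf_tet_def nondeg_def)
  then have F: "verts K - {v'} \<in> faces K" by (auto simp: faces_def)
  obtain x y z where xyz: "verts K - {v'} = {x, y, z}" "fmark K (verts K - {v'}) = {x, y}"
    using face_marked[OF wf F] by metis
  \<comment> \<open>The second and third kept vertices are both set to \<open>x\<close> merely to
    enter the locale; other choices are reached through \<open>macro_child_variants\<close>.\<close>
  have "macro_child K (child (child (child K v) x) x) v v' x y z x z"
    by unfold_locales (use wf uf r xyz in auto)
  then show ?thesis using that by blast
qed

lemma macro_child_variants:
  assumes "macro_child K K' v v' x y z w w'"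
  shows "macro_child K (child (child (child K v) x) x) v v' x y z x z"
    "macro_child K (child (child (child K v) x) z) v v' x y z z x"
    "macro_child K (child (child (child K v) y) y) v v' y x z y z"
  using assms unfolding macro_child_def by (simp_all add: insert_commute disj_commute)

text \<open>Three bisections can always be chosen so as to keep a given vertex.\<close>

lemma mesh_verts_step:
  assumes gm: "good_mesh U"
  shows "mesh_verts U \<subseteq> mesh_verts (macro_step U)"
proof
  fix u assume "u \<in> mesh_verts U"
  then obtain K where K: "K \<in> U" "u \<in> verts K" by (auto simp: mesh_verts_def)
  have wf: "wf_tet K" and uf: "\<not> flag K" using good_meshD[OF gm K(1)] by blast+
  then have "redge K \<noteq> {}" by (auto simp: wf_tet_def edges_def)
  \<comment> \<open>If \<open>u\<close> lies on the refinement edge, the child at \<open>u\<close>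
    must be taken; otherwise either child contains it.\<close>
  then obtain v where vu: "v \<in> redge K" "u \<in> redge K \<longrightarrow> v = u" by blast
  obtain v' x y z where m: "macro_child K (child (child (child K v) x) x) v v' x y z x z"
    using macro_child_start[OF wf uf vu(1)] .
  interpret macro_child K "child (child (child K v) x) x" v v' x y z x z by fact
  have "u \<noteq> v'" using vu(2) redge dist0 v by auto
  then have "u \<in> {x, y, z}" using K(2) verts by auto
  moreover have "\<exists>K'. K' \<in> macro_step U \<and> u \<in> verts K'"
    if "macro_child K K' v v' a b c u d" for K' a b c d
  proof -
    interpret B: macro_child K K' v v' a b c u d by fact
    show ?thesis using that K(1) B.K'_facts(1) unfolding macro_step_def by blast
  qed
  ultimately show "u \<in> mesh_verts (macro_step U)"
    using macro_child_variants[OF m] unfolding mesh_verts_def by blast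
qed

lemma (in macro_child) midpoints_new:
  assumes "good_mesh U" "K \<in> U"
  shows "m \<notin> mesh_verts U" "n \<notin> mesh_verts U" "p \<notin> mesh_verts U"
proof -
  have "{v, v'} \<in> mesh_edges U" "{x, y} \<in> mesh_edges U" "{x, z} \<in> mesh_edges U"
    using assms(2) verts dist0 v by (auto simp: mesh_edges_def edges_def intro!: bexI[of _ K])
  then show "m \<notin> mesh_verts U" "n \<notin> mesh_verts U" "p \<notin> mesh_verts U"
    using emid_not_vertex[OF assms(1)] unfolding m_def n_def p_def by (metis emid_doubleton)+
qed

text \<open>An element of the next mesh has \<open>w\<close> as its only old vertex. An edge that
  recurred in a later macro mesh would have two old endpoints, so macro-generations are
  unique.\<close>

lemma macro_step_edge_new:
  assumes gm: "good_mesh U" and e: "e \<in> mesh_edges (macro_step U)"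
  shows "\<not> e \<subseteq> mesh_verts U"
proof
  assume sub: "e \<subseteq> mesh_verts U"
  obtain K' where eK': "K' \<in> macro_step U" "e \<in> edges K'" using e by (auto simp: mesh_edges_def)
  then obtain K v v' x y z w w' where KU: "K \<in> U" and mK: "macro_child K K' v v' x y z w w'"
    by (auto simp: macro_step_def)
  interpret macro_child K K' v v' x y z w w' by fact
  have "e \<subseteq> {w}" using eK'(2) sub midpoints_new[OF gm KU] by (auto simp: edges_def K'_facts(1))
  then have "card e \<le> 1" using card_mono[of "{w}" e] by simp
  then show False using eK'(2) by (simp add: edges_def)
qed

lemma mesh_verts_macro_mono:
  assumes "initial_amp_mesh \<Omega> T0" "p \<le> q"
  shows "mesh_verts (macro_mesh T0 p) \<subseteq> mesh_verts (macro_mesh T0 q)"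
  using assms(2)
proof (rule lift_Suc_mono_le[of "\<lambda>n. mesh_verts (macro_mesh T0 n)", rotated])
  fix n show "mesh_verts (macro_mesh T0 n) \<subseteq> mesh_verts (macro_mesh T0 (Suc n))"
    using good_mesh_macro[OF assms(1), of n] mesh_verts_step by simp
qed

lemma mesh_edges_subset_verts: "e \<in> mesh_edges U \<Longrightarrow> e \<subseteq> mesh_verts U"
  by (auto simp: mesh_edges_def mesh_verts_def edges_def)

lemma mgen_not_less:
  assumes "initial_amp_mesh \<Omega> T0" "has_mgen T0 e p" "has_mgen T0 e q"
  shows "\<not> p < q"
proof
  assume "p < q"
  then obtain r where r: "q = Suc r" "p \<le> r" by (metis less_Suc_eq_le not0_implies_Suc not_less0)
  have "e \<subseteq> mesh_verts (macro_mesh T0 r)"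
    using assms(2) mesh_edges_subset_verts mesh_verts_macro_mono[OF assms(1) r(2)]
    unfolding has_mgen_def by blast
  moreover have "\<not> e \<subseteq> mesh_verts (macro_mesh T0 r)"
    using good_mesh_macro[OF assms(1), of r] assms(3) macro_step_edge_new
    by (simp add: has_mgen_def r(1))
  ultimately show False by blast
qed

lemma mgen_unique:
  assumes "initial_amp_mesh \<Omega> T0" "has_mgen T0 e p" "has_mgen T0 e q"
  shows "p = q"
  using mgen_not_less[OF assms] mgen_not_less[OF assms(1,3,2)] by simp

section \<open>Events of a call as nodes of the uniform refinement tree\<close>

definition in_tree :: "marked_tet set \<Rightarrow> marked_tet \<Rightarrow> bool" where
  "in_tree T0 K \<longleftrightarrow> (\<exists>n. K \<in> ((\<lambda>T. bisect_all T T) ^^ n) T0)"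

text \<open>Adaptive and uniform refinement use the same operation \<open>child\<close>, so an
  adaptively produced element occurs in some uniform refinement of the initial mesh.\<close>

lemma in_tree_bisect:
  assumes "\<forall>K\<in>T. in_tree T0 K" "B \<subseteq> T"
  shows "\<forall>K\<in>bisect_all T B. in_tree T0 K"
proof
  fix K assume "K \<in> bisect_all T B"
  then consider "K \<in> T" | L where "L \<in> T" "K \<in> children L"
    using assms(2) by (auto simp: bisect_all_def)
  then show "in_tree T0 K"
  proof cases
    case 2
    then obtain n where "L \<in> ((\<lambda>T. bisect_all T T) ^^ n) T0" using assms(1) by (auto simp: in_tree_def)
    then have "K \<in> ((\<lambda>T. bisect_all T T) ^^ Suc n) T0" using 2(2) by (auto simp: bisect_all_self)
    then show ?thesis unfolding in_tree_def by blast
  qed (use assms(1) in blast)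
qed

lemma in_tree_descendant: "descendant_mesh T0 T \<Longrightarrow> \<forall>K\<in>T. in_tree T0 K"
proof (induction rule: descendant_mesh.induct)
  case init
  have "K \<in> ((\<lambda>T. bisect_all T T) ^^ 0) T0" if "K \<in> T0" for K using that by simp
  then show ?case unfolding in_tree_def by blast
next
  case (bisect T K)
  then show ?case by (intro in_tree_bisect) auto
qed

lemma in_tree_amp_state:
  assumes "\<forall>K\<in>T. in_tree T0 K" "M \<subseteq> T"
  shows "\<forall>K\<in>amp_state T M n. in_tree T0 K"
proof (induction n)
  case (Suc n)
  then show ?case unfolding amp_state.simps
    by (intro in_tree_bisect) (use assms(2) in \<open>auto simp: hanging_elems_def\<close>)
qed (use assms in simp)

lemma in_tree_event:
  assumes "descendant_mesh T0 T" "M \<subseteq> T" "K \<in> events T M"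
  shows "in_tree T0 K"
  using in_tree_amp_state[OF in_tree_descendant[OF assms(1)] assms(2)] in_tree_descendant[OF assms(1)] assms(2,3)
  by (auto simp: events_def amp_batch_def hanging_elems_def split: if_splits)

lemma in_tree_cases:
  assumes "in_tree T0 T"
  obtains q K v x where "K \<in> macro_mesh T0 q" "v \<in> redge K" "x \<in> redge (child K v)"
      "T = child (child K v) x"
  | q K v where "K \<in> macro_mesh T0 q" "v \<in> redge K" "T = child K v"
  | q where "T \<in> macro_mesh T0 q"
proof -
  let ?f = "\<lambda>T. bisect_all T T"
  obtain n where n: "T \<in> (?f ^^ n) T0" using assms by (auto simp: in_tree_def)
  define q where "q = n div 3"
  \<comment> \<open>The remainder of the depth modulo three is the number of levels below the
    nearest macro mesh.\<close>
  have "n = 3 * q \<or> n = Suc (3 * q) \<or> n = Suc (Suc (3 * q))" unfolding q_def by presburger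
  then show ?thesis
  proof (elim disjE)
    assume "n = 3 * q"
    then show ?thesis using n that(3)[of q] by (simp add: macro_mesh_def)
  next
    assume "n = Suc (3 * q)"
    then have "T \<in> \<Union> (children ` macro_mesh T0 q)" using n by (simp add: macro_mesh_def bisect_all_self)
    then show ?thesis using that(2) by (auto simp: children_def)
  next
    assume "n = Suc (Suc (3 * q))"
    then have "T \<in> \<Union> (children ` \<Union> (children ` macro_mesh T0 q))"
      using n by (simp add: macro_mesh_def bisect_all_self)
    then show ?thesis using that(1) by (auto simp: children_def)
  qed
qed

section \<open>Transitions\<close>

text \<open>One and two levels below \<open>K\<close> the refinement edges are \<open>{x, y}\<close>
  and \<open>{a, z}\<close>, both edges of \<open>K\<close>. The vertices added on the way do not
  belong to the mesh; after one bisection this leaves the edges of the inherited face, and after two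
  only the refinement edge itself, which is excluded.\<close>

lemma refinement_edges_below:
  assumes gm: "good_mesh U" and K: "K \<in> U"
    and T: "T = K \<or> (\<exists>v\<in>redge K. T = child K v \<or> (\<exists>x\<in>redge (child K v). T = child (child K v) x))"
  shows "redge T \<in> edges K"
    and "e \<in> edges T \<Longrightarrow> e \<subseteq> mesh_verts U \<Longrightarrow> e \<noteq> redge T \<Longrightarrow>
      redge T = redge K \<and> e \<in> edges K \<or>
      (\<exists>F\<in>nonref_faces K. redge T = fmark K F \<and> e \<subseteq> F \<and> card e = 2)"
proof -
  have wf: "wf_tet K" and uf: "\<not> flag K" using good_meshD[OF gm K] by blast+
  have "redge T \<in> edges K \<and> (e \<in> edges T \<longrightarrow> e \<subseteq> mesh_verts U \<longrightarrow> e \<noteq> redge T \<longrightarrow>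
      redge T = redge K \<and> e \<in> edges K \<or>
      (\<exists>F\<in>nonref_faces K. redge T = fmark K F \<and> e \<subseteq> F \<and> card e = 2))"
  proof (cases "T = K")
    case True
    then show ?thesis using wf by (simp add: wf_tet_def)
  next
    case False
    then obtain vv where vv: "vv \<in> redge K"
      and Tc: "T = child K vv \<or> (\<exists>x\<in>redge (child K vv). T = child (child K vv) x)" using T by blast
    obtain v' x y z where m: "macro_child K (child (child (child K vv) x) x) vv v' x y z x z"
      using macro_child_start[OF wf uf vv] .
    interpret macro_child K "child (child (child K vv) x) x" vv v' x y z x z by fact
    have Fn: "{x, y, z} \<in> nonref_faces K"
      using dist0 redge by (auto simp: nonref_faces_def faces_def verts)
    \<comment> \<open>Both children of \<open>D\<close> are treated alike: \<open>a\<close> is the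
      kept endpoint of \<open>{x, y}\<close> and \<open>b\<close> the other one.\<close>
    have "\<exists>a b. T = child D a \<and> macro_child K (child (child (child K vv) a) a) vv v' a b z a z"
      if "T \<noteq> D"
    proof -
      obtain a where "a \<in> {x, y}" "T = child D a" using Tc \<open>T \<noteq> D\<close> D_facts(2) by (auto simp: D_def)
      then show ?thesis using m macro_child_variants(3)[OF m] by blast
    qed
    then consider "T = D"
      | a b where "T = child D a" "macro_child K (child (child (child K vv) a) a) vv v' a b z a z" by blast
    then show ?thesis
    proof cases
      case 1
      have "e \<subseteq> {x, y, z} \<and> card e = 2" if "e \<in> edges T" "e \<subseteq> mesh_verts U"
        using that midpoints_new(1)[OF gm K] unfolding edges_def 1 D_facts(1) by blast
      moreover have "redge T = fmark K {x, y, z}" using 1 D_facts(2) mark by simp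
      moreover have "redge T \<in> edges K" using 1 D_facts(2) dist0 by (auto simp: edges_def verts)
      ultimately show ?thesis using Fn by blast
    next
      case 2
      interpret B: macro_child K "child (child (child K vv) a) a" vv v' a b z a z by fact
      have TG: "T = B.G" using 2(1) by (simp add: B.G_def B.D_def D_def)
      have "redge T \<in> edges K" using TG B.G_facts(2) B.dist0 by (auto simp: edges_def B.verts)
      moreover have "e = redge T" if "e \<in> edges T" "e \<subseteq> mesh_verts U"
      proof -
        have "e \<subseteq> {a, z}" "card e = 2"
          using that B.midpoints_new(1,2)[OF gm K] unfolding edges_def TG B.G_facts(1) by blast+
        moreover have "card {a, z} = 2" using B.dist0 by simp
        ultimately show ?thesis using card_subset_eq[of "{a, z}" e] TG B.G_facts(2) by simp
      qed
      ultimately show ?thesis by blast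
    qed
  qed
  then show "redge T \<in> edges K"
    and "e \<in> edges T \<Longrightarrow> e \<subseteq> mesh_verts U \<Longrightarrow> e \<noteq> redge T \<Longrightarrow>
      redge T = redge K \<and> e \<in> edges K \<or>
      (\<exists>F\<in>nonref_faces K. redge T = fmark K F \<and> e \<subseteq> F \<and> card e = 2)" by blast+
qed

lemma card_2_subset_triple:
  assumes "e \<subseteq> {a, b, c}" "card e = 2"
  shows "e = {a, b} \<or> e = {a, c} \<or> e = {b, c}"
  using assms by (auto simp: card_2_iff)

lemma card_2_subset_quadruple:
  assumes "e \<subseteq> {a, b, c, d}" "card e = 2"
  shows "e = {a, b} \<or> e = {a, c} \<or> e = {a, d} \<or> e = {b, c} \<or> e = {b, d} \<or> e = {c, d}"
proof -
  obtain s t where "e = {s, t}" "s \<noteq> t" using assms(2) by (auto simp: card_2_iff)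
  moreover have "s \<in> {a, b, c, d}" "t \<in> {a, b, c, d}" using assms(1) calculation by auto
  ultimately show ?thesis by (elim insertE emptyE) (simp_all add: insert_commute)
qed

section \<open>Classes and positions of the edges of a macro child\<close>

context macro_child
begin

text \<open>In both types each nonrefinement mark meets the refinement edge \<open>{v, v'}\<close>:
  by definition for A, by the triangle criterion for \<open>P_u\<close>. Since \<open>v'\<close> is
  not in the face \<open>{x, y, z}\<close>, the meeting point is \<open>v\<close>.\<close>

lemma marked_at_v:
  assumes "tet_type K = Type_A \<or> tet_type K = Type_Pu"
  shows "v = x \<or> v = y"
proof -
  obtain c d where cd: "{v, c, d} = {x, y, z}" "distinct [v, c, d]"
    using v dist0 by (elim insertE emptyE) auto
  have *: "{v, v', c, d} = insert v' {v, c, d}" by auto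
  have V: "verts K = {v, v', c, d}" unfolding * cd(1) verts ..
  have N: "nondeg {v, v', c, d}" using nd unfolding * cd(1) .
  have D: "distinct [v, v', c, d]" by (rule nondeg_distinct[OF N])
  have fx: "fmark K {v, c, d} = {x, y}" using mark cd by simp
  have "fmark K {v, c, d} \<inter> {v, v'} \<noteq> {}"
    using assms
  proof
    assume "tet_type K = Type_A"
    then have "\<forall>F\<in>nonref_faces K. fmark K F \<inter> redge K \<noteq> {}"
      by (auto simp: tet_type_def split: if_splits)
    then show ?thesis using nonref_faces_eq[OF V D redge] redge by simp
  next
    assume "tet_type K = Type_Pu"
    then have mc: "marks_coplanar K" by (auto simp: tet_type_def split: if_splits)
    have f: "{v, v', c} \<in> faces K" "{v, v', d} \<in> faces K" "{v, c, d} \<in> faces K" "{v', c, d} \<in> faces K"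
      unfolding faces_eq[OF V D] by simp_all
    have "\<exists>w\<in>{c, d}. fmark K {v, c, d} = {v, w} \<and> fmark K {v', c, d} = {v', w}"
      using mc by (subst (asm) marks_coplanar_iff[OF V N redge]) (use wf f redge in \<open>simp_all add: wf_tet_def\<close>)
    then show ?thesis by auto
  qed
  then show ?thesis using fx dist0 by auto
qed

text \<open>Because \<open>v\<close> is \<open>x\<close> or \<open>y\<close>, the point
  \<open>n\<close> halves an edge at \<open>v\<close>, so \<open>{n, m}\<close> is a midline of a
  refinement face; the same holds for \<open>{p, m}\<close> if \<open>v = x\<close>. If
  \<open>v = y\<close>, then \<open>p\<close> halves the edge opposite the refinement edge, which
  gives the inner classes.\<close>

lemma edge_classes:
  assumes gm: "good_mesh U" and KU: "K \<in> U" and t: "tet_type K = Type_A \<or> tet_type K = Type_Pu"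
  defines "cl \<equiv> \<lambda>e. THE c. has_cls U e c"
  shows "cl {w, p} = Cls_H" "cl {w, n} = (if w = x then Cls_H else Cls_V)"
    "cl {w, m} = (if w = v then Cls_H else Cls_V)" "cl {p, n} = Cls_Mf" "cl {n, m} = Cls_Mf"
    "cl {p, m} = (if v = x then Cls_Mf else if tet_type K = Type_Pu then Cls_IP else Cls_IA)"
proof -
  have cl: "cl e = c" if "has_cls U e c" for e c unfolding cl_def by (rule The_cls[OF gm that])
  have vxy: "v = x \<or> v = y" by (rule marked_at_v[OF t])
  have F: "{x, y, z} \<in> faces K" using dist0 by (auto simp: faces_def verts)
  have R: "{v, v', u} \<in> faces K \<and> fmark K {v, v', u} = {v, v'}" if "u \<in> {x, y, z}" "u \<noteq> v" for u
  proof -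
    have "{v, v', u} \<in> faces K" using that v dist0 by (auto simp: faces_def verts)
    then show ?thesis using wf redge by (simp add: wf_tet_def)
  qed
  have p': "p = midpoint w w'" using w by (auto simp: p_def midpoint_sym)
  have wE: "{w, w'} \<in> edges K" "{x, y} \<in> edges K" "{v, v'} \<in> edges K"
    using w v dist0 by (auto simp: edges_def verts)
  show "cl {w, p} = Cls_H" unfolding p' by (intro cl has_cls.H[OF KU wE(1)])
  show "cl {w, n} = (if w = x then Cls_H else Cls_V)"
  proof (cases "w = x")
    case True
    then show ?thesis using has_cls.H[OF KU wE(2)] by (simp add: n_def cl)
  next
    case False
    then have "w = z" using w by auto
    then show ?thesis using has_cls.V[OF KU F mark] False by (simp add: n_def cl)
  qed
  show "cl {w, m} = (if w = v then Cls_H else Cls_V)"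
  proof (cases "w = v")
    case True
    then show ?thesis using has_cls.H[OF KU wE(3)] by (simp add: m_def cl)
  next
    case False
    then have "has_cls U {w, midpoint v v'} Cls_V" using R[of w] w by (intro has_cls.V[OF KU]) auto
    then show ?thesis using False by (simp add: m_def cl)
  qed
  show "cl {p, n} = Cls_Mf"
    using cl[OF has_cls.Mf[OF KU F mark]] by (simp add: n_def p_def insert_commute)
  have mf: "cl {m, midpoint v u} = Cls_Mf" if "u \<in> {x, y, z}" "u \<noteq> v" for u
    unfolding m_def using R[OF that] by (intro cl has_cls.Mf[OF KU]) auto
  have "\<exists>u\<in>{x, y, z}. u \<noteq> v \<and> n = midpoint v u"
    using vxy dist0 by (auto simp: n_def midpoint_sym)
  then show "cl {n, m} = Cls_Mf" using mf by (auto simp: insert_commute)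
  show "cl {p, m} = (if v = x then Cls_Mf else if tet_type K = Type_Pu then Cls_IP else Cls_IA)"
  proof (cases "v = x")
    case True
    then have "cl {m, p} = Cls_Mf" using mf[of z] dist0 by (simp add: p_def eq_commute[of z])
    then show ?thesis using True by (simp add: insert_commute)
  next
    case False
    then have "verts K - redge K = {x, z}" using vxy dist0 verts redge by auto
    then have e: "{emid (redge K), emid (verts K - redge K)} = {p, m}"
      by (simp add: redge m_def p_def insert_commute)
    show ?thesis
    proof (cases "tet_type K = Type_Pu")
      case True
      then show ?thesis using cl[OF has_cls.IP[OF KU True]] False e by simp
    next
      case pu: False
      then have "tet_type K = Type_A" using t by simp
      then show ?thesis using cl[OF has_cls.IA[OF KU]] False pu e by simp
    qed
  qed
qed

text \<open>The H- and V-edges of \<open>K'\<close> are exactly its edges at \<open>w\<close>, which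
  gives the common endpoint. The refinement edge is \<open>{w, n}\<close> for type
  \<open>P_u\<close> with \<open>w = z\<close>, and \<open>{w, m}\<close> otherwise; the
  nonrefinement faces differ accordingly.\<close>

lemma transition:
  assumes gm: "good_mesh U" and KU: "K \<in> U" and t: "tet_type K = Type_A \<or> tet_type K = Type_Pu"
    and e: "e2 = redge K' \<and> e1 \<in> edges K' \<or> (\<exists>F\<in>nonref_faces K'. e2 = fmark K' F \<and> e1 \<subseteq> F \<and> card e1 = 2)"
    and ne: "e1 \<noteq> e2"
  defines "cl \<equiv> \<lambda>e. THE c. has_cls U e c"
  shows "(cl e1, cl e2) \<in> {(Cls_H, Cls_H), (Cls_H, Cls_V), (Cls_V, Cls_V),
            (Cls_Mf, Cls_H), (Cls_Mf, Cls_V), (Cls_Mf, Cls_Mf), (Cls_Mf, Cls_IA),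
            (Cls_IA, Cls_V), (Cls_IP, Cls_V), (Cls_IP, Cls_Mf)} \<and>
         ((cl e1, cl e2) \<in> {(Cls_H, Cls_H), (Cls_H, Cls_V), (Cls_V, Cls_V)} \<longrightarrow> w \<in> e1 \<and> w \<in> e2)"
proof -
  have "cl e = (THE c. has_cls U e c)" for e by (simp add: cl_def)
  note cls = edge_classes[OF gm KU t, folded this]
  have vxy: "v = x \<or> v = y" by (rule marked_at_v[OF t])
  have red: "e1 = {w, p} \<or> e1 = {w, n} \<or> e1 = {w, m} \<or> e1 = {p, n} \<or> e1 = {p, m} \<or> e1 = {n, m}"
    if "e1 \<in> edges K'"
    using that card_2_subset_quadruple[of e1 w p n m] by (simp add: edges_def K'_facts(1))
  show ?thesis
  proof (cases "tet_type K = Type_Pu \<and> w = z")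
    case True
    \<comment> \<open>\<open>v\<close> is \<open>x\<close> or \<open>y\<close>, so
      \<open>w = z\<close> is not \<open>v\<close>; both marked edges at \<open>w\<close> then have
      class V.\<close>
    have nw: "w \<noteq> x" "w \<noteq> v" using True vxy dist0 by auto
    have c2: "cl {w, n} = Cls_V" "cl {w, m} = Cls_V" "cl {p, m} \<in> {Cls_Mf, Cls_IP}"
      using cls nw True by auto
    have mk: "fmark K' {w, p, m} = {w, m}" "fmark K' {p, n, m} = {n, m}" "redge K' = {w, n}"
      using K'_facts(3,5,7) True by simp_all
    have nr: "nonref_faces K' = {{w, p, m}, {p, n, m}}" using True nonref_faces_K' by simp
    have "e2 = {w, n} \<and> (e1 = {w, p} \<or> e1 = {w, m} \<or> e1 = {p, n} \<or> e1 = {p, m} \<or> e1 = {n, m}) \<or>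
      e2 = {w, m} \<and> (e1 = {w, p} \<or> e1 = {p, m}) \<or> e2 = {n, m} \<and> (e1 = {p, n} \<or> e1 = {p, m})"
      using e unfolding nr mk(3)
    proof (elim disjE conjE bexE insertE emptyE)
      assume "e2 = {w, n}" "e1 \<in> edges K'"
      then show ?thesis using red ne by metis
    next
      fix F assume "e2 = fmark K' F" "e1 \<subseteq> F" "card e1 = 2" "F = {w, p, m}"
      then show ?thesis using card_2_subset_triple[of e1 w p m] mk(1) ne by metis
    next
      fix F assume "e2 = fmark K' F" "e1 \<subseteq> F" "card e1 = 2" "F = {p, n, m}"
      then show ?thesis using card_2_subset_triple[of e1 p n m] mk(2) ne by metis
    qed
    then show ?thesis using cls(1,4,5) c2
      by (elim disjE conjE) auto
  next
    case False
    \<comment> \<open>\<open>{w, m}\<close> has class H only for \<open>w = v\<close>, which forces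
      both to be \<open>x\<close>; then \<open>{w, n}\<close> is H and \<open>{p, m}\<close> a
      midline. This coupling excludes transitions into H from V or from an inner class.\<close>
    have c2: "cl {w, m} = Cls_H \<and> cl {w, n} = Cls_H \<and> cl {p, m} = Cls_Mf \<or> cl {w, m} = Cls_V"
      "cl {w, n} = Cls_H \<or> cl {w, n} = Cls_V"
      "cl {p, m} = Cls_Mf \<or> cl {p, m} = (if tet_type K = Type_Pu then Cls_IP else Cls_IA)"
      using cls(2,3,6) w vxy dist0 by auto
    have mk: "fmark K' {w, p, n} = {w, n}" "redge K' = {w, m}"
      "fmark K' {p, n, m} = (if tet_type K = Type_Pu then {n, m} else {p, m})"
      using False by (auto simp: K'_facts)
    have nr: "nonref_faces K' = {{w, p, n}, {p, n, m}}" using False nonref_faces_K' by auto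
    have "e2 = {w, m} \<and> (e1 = {w, p} \<or> e1 = {w, n} \<or> e1 = {p, n} \<or> e1 = {p, m} \<or> e1 = {n, m}) \<or>
      e2 = {w, n} \<and> (e1 = {w, p} \<or> e1 = {p, n}) \<or>
      tet_type K = Type_Pu \<and> e2 = {n, m} \<and> (e1 = {p, n} \<or> e1 = {p, m}) \<or>
      tet_type K \<noteq> Type_Pu \<and> e2 = {p, m} \<and> (e1 = {p, n} \<or> e1 = {n, m})"
      using e unfolding nr mk(2)
    proof (elim disjE conjE bexE insertE emptyE)
      assume "e2 = {w, m}" "e1 \<in> edges K'"
      then show ?thesis using red ne by metis
    next
      fix F assume "e2 = fmark K' F" "e1 \<subseteq> F" "card e1 = 2" "F = {w, p, n}"
      then show ?thesis using card_2_subset_triple[of e1 w p n] mk(1) ne by metis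
    next
      fix F assume "e2 = fmark K' F" "e1 \<subseteq> F" "card e1 = 2" "F = {p, n, m}"
      then show ?thesis using card_2_subset_triple[of e1 p n m] mk(3) ne by metis
    qed
    then show ?thesis using cls(1,4,5) c2
      by (elim disjE conjE) (simp_all split: if_splits)
  qed
qed

lemma old_vertex_unique:
  assumes gm: "good_mesh U" and KU: "K \<in> U" and "e \<in> edges K'" "w \<in> e"
  shows "(THE u. u \<in> e \<and> u \<in> mesh_verts U) = w"
proof (rule the_equality)
  have "w \<in> mesh_verts U" using KU verts w by (auto simp: mesh_verts_def)
  then show "w \<in> e \<and> w \<in> mesh_verts U" using assms(4) by simp
  show "u = w" if "u \<in> e \<and> u \<in> mesh_verts U" for u
    using that assms(3) midpoints_new[OF gm KU] by (auto simp: edges_def K'_facts(1))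
qed

end

theorem lemma4p5:
  fixes \<Omega> :: "point set" and T0 T M :: "marked_tet set"
    and par :: "marked_tet \<Rightarrow> marked_tet" and Ks :: "marked_tet list"
    and q a b j :: nat and e1 e2 :: "point set"
  assumes "initial_amp_mesh \<Omega> T0"
    and "q \<ge> 2"
    and "descendant_mesh T0 T"
    and "conformingly_marked \<Omega> T"
    and "M \<subseteq> T"
    and "causal_parent T M par"
    and "causal_chain T M par Ks"
    and "horizontal_block T0 q Ks a b"
    and "a \<le> j" and "Suc j \<le> b"
    and "e1 = redge (Ks ! j)"
    and "e2 = redge (Ks ! Suc j)"
    and "e1 \<noteq> e2"
  shows "(cls T0 q e1, cls T0 q e2) \<in>
           {(Cls_H, Cls_H), (Cls_H, Cls_V), (Cls_V, Cls_V),
            (Cls_Mf, Cls_H), (Cls_Mf, Cls_V), (Cls_Mf, Cls_Mf), (Cls_Mf, Cls_IA),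
            (Cls_IA, Cls_V), (Cls_IP, Cls_V), (Cls_IP, Cls_Mf)} \<and>
         ((cls T0 q e1, cls T0 q e2) \<in> {(Cls_H, Cls_H), (Cls_H, Cls_V), (Cls_V, Cls_V)} \<longrightarrow>
            anchor T0 q e1 = anchor T0 q e2)"
proof -
  define S where "S = Ks ! Suc j"
  have jl: "Suc j < length Ks" and mg: "has_mgen T0 e1 q" "has_mgen T0 e2 q"
    using assms(8-12) by (auto simp: horizontal_block_def)
  then have S: "S \<in> events T M" "S \<notin> amp_batch T M 0" "par S = Ks ! j"
    using assms(7) by (auto simp: causal_chain_def S_def)
  then obtain k where "S \<in> amp_batch T M k" "k > 0" by (auto simp: events_def intro: gr0I)
  then have e1S: "e1 \<in> edges S" using assms(6,11) S(3) unfolding causal_parent_def by metis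
  have e2S: "e2 = redge S" using assms(12) by (simp add: S_def)
  have gm: "good_mesh (macro_mesh T0 r)" and st: "macro_mesh T0 (Suc r) = macro_step (macro_mesh T0 r)" for r
    using good_mesh_macro[OF assms(1)] by blast+
  \<comment> \<open>The macro-generation \<open>r\<close> of the enclosing element is identified
    with \<open>q\<close> only once \<open>e2\<close> is known to be an edge of
    \<open>K\<close>.\<close>
  obtain r K where K: "K \<in> macro_mesh T0 r" and below: "S = K \<or> (\<exists>v\<in>redge K. S = child K v \<or>
      (\<exists>x\<in>redge (child K v). S = child (child K v) x))"
    using in_tree_cases[OF in_tree_event[OF assms(3,5) S(1)]] by metis
  have "e2 \<in> edges K" using refinement_edges_below(1)[OF gm K below] e2S by simp
  then have "has_mgen T0 e2 r" using K by (auto simp: has_mgen_def mesh_edges_def)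
  then have "r = q" using mgen_unique[OF assms(1) _ mg(2)] by blast
  have "e1 \<subseteq> mesh_verts (macro_mesh T0 r)"
    using mg(1) mesh_edges_subset_verts \<open>r = q\<close> by (simp add: has_mgen_def)
  then have pos: "e2 = redge K \<and> e1 \<in> edges K \<or>
      (\<exists>F\<in>nonref_faces K. e2 = fmark K F \<and> e1 \<subseteq> F \<and> card e1 = 2)"
    using refinement_edges_below(2)[OF gm K below e1S] e2S assms(13) by simp
  then have e1K: "e1 \<in> edges K" by (auto simp: nonref_faces_def faces_def edges_def)
  \<comment> \<open>With q at least 2 the mesh U_(q-1) is itself the result of a macro step, so its
    elements have type A or \<open>P_u\<close>.\<close>
  obtain s where s: "q = Suc (Suc s)" using assms(2) by (metis add_2_eq_Suc le_Suc_ex)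
  define U where "U = macro_mesh T0 (q - 1)"
  have gU: "good_mesh U" unfolding U_def by (rule gm)
  have "K \<in> macro_step U" using K \<open>r = q\<close> s st by (simp add: U_def)
  then obtain L v v' x y z w w' where L: "L \<in> U" and mL: "macro_child L K v v' x y z w w'"
    by (auto simp: macro_step_def)
  have t: "tet_type L = Type_A \<or> tet_type L = Type_Pu"
    using L macro_step_type s st by (simp add: U_def)
  interpret macro_child L K v v' x y z w w' by fact
  have "w \<in> e1 \<and> w \<in> e2 \<longrightarrow> anchor T0 q e1 = anchor T0 q e2"
    using old_vertex_unique[OF gU L e1K] old_vertex_unique[OF gU L \<open>e2 \<in> edges K\<close>]
    by (simp add: anchor_def U_def)
  then show ?thesis
    using transition[OF gU L t pos assms(13)] unfolding cls_def U_def[symmetric] by blast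
qed

end
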